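(* Let $X$ be the Cantor space, $\varphi$ a minimal homeomorphism of $X$, and $x\in X$. Then the orbit equivalence relations on $X$ induced by $\varphi$ and by the group $\Gamma_x(\varphi)$ are isomorphic.
   Context: A homeomorphism $\varphi$ of $X$ is minimal if all orbits $\{\varphi^n(y)\colon n\in\mathbb{Z}\}$ are dense. A Kakutani--Rokhlin partition for $\varphi$ is a finite clopen partition $(U_{i,j})_{i\in I,\,0\le j<n_i}$ of $X$ such that $\varphi(U_{i,j})=U_{i,j+1}$ for all $i$ and all $j<n_i-1$; its base is $\bigcup_i U_{i,0}$, its columns are the families $(U_{i,j})_{0\le j<n_i}$. A Kakutani--Rokhlin partition $\mathcal{B}$ refines $\mathcal{A}$ if every atom of $\mathcal{B}$ is contained in an atom of $\mathcal{A}$ and the base of $\mathcal{B}$ is contained in the base of $\mathcal{A}$. Fix $x\in X$ and a refining sequence $(\mathcal{A}_n)$ of Kakutani--Rokhlin partitions such that every clopen set is a union of atoms of $\mathcal{A}_n$ for all large $n$, and the intersection of the bases of the $\mathcal{A}_n$ is $\{x\}$ (such a sequence exists). Let $\Gamma_n$ be the group of all homeomorphisms $g$ of $X$ such that for every atom $U_{i,j}$ of $\mathcal{A}_n$ there is an integer $k_{i,j}$ with $0\le j+k_{i,j}<n_i$ and $g(y)=\varphi^{k_{i,j}}(y)$ for all $y\in U_{i,j}$. Then $\Gamma_x(\varphi)=\bigcup_n\Gamma_n$. It does not depend on the choice of $(\mathcal{A}_n)$: it equals the set of $g\in F(\varphi)$ with $g(O^+(x))=O^+(x)$, where $O^+(x)=\{\varphi^n(x)\colon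 n\ge0\}$ and $F(\varphi)$ is the group of homeomorphisms $g$ of $X$ for which there is a finite $A\subset\mathbb{Z}$ such that for all $y\in X$ there is $n\in A$ with $g(y)=\varphi^n(y)$. Two equivalence relations $R,S$ on $X$ are isomorphic if there is a homeomorphism $g$ of $X$ such that for all $y,y'$: $yRy'$ iff $g(y)Sg(y')$. *)

theory Defs
  imports "HOL-Analysis.Analysis"
begin

definition homeo :: "('a::topological_space \<Rightarrow> 'a) \<Rightarrow> bool"
  where "homeo g \<longleftrightarrow> (\<exists>h. homeomorphism UNIV UNIV g h)"

definition iter :: "('a \<Rightarrow> 'a) \<Rightarrow> int \<Rightarrow> 'a \<Rightarrow> 'a"
  where "iter f k = (if 0 \<le> k then f ^^ nat k else inv f ^^ nat (- k))"

definition minimal_homeo :: "('a::topological_space \<Rightarrow> 'a) \<Rightarrow> bool"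
  where "minimal_homeo \<phi> \<longleftrightarrow> homeo \<phi> \<and> (\<forall>y. closure (range (\<lambda>n. iter \<phi> n y)) = UNIV)"

(* The finite index set I of the columns is a set of naturals; only the values of height on I
   and of atom i j for i in I and j < height i are relevant. *)
record 'a kr =
  cols :: "nat set"
  height :: "nat \<Rightarrow> nat"
  atom :: "nat \<Rightarrow> nat \<Rightarrow> 'a set"

definition kr_ix :: "'a kr \<Rightarrow> (nat \<times> nat) set"
  where "kr_ix P = (SIGMA i:cols P. {..<height P i})"

definition kr_atoms :: "'a kr \<Rightarrow> 'a set set"
  where "kr_atoms P = (\<lambda>(i, j). atom P i j) ` kr_ix P"

definition kr_base :: "'a kr \<Rightarrow> 'a set"
  where "kr_base P = (\<Union>i\<in>cols P. atom P i 0)"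

definition kr_partition :: "('a::topological_space \<Rightarrow> 'a) \<Rightarrow> 'a kr \<Rightarrow> bool"
  where "kr_partition \<phi> P \<longleftrightarrow>
    finite (cols P) \<and>
    (\<forall>i\<in>cols P. 0 < height P i) \<and>
    (\<forall>U\<in>kr_atoms P. open U \<and> closed U \<and> U \<noteq> {}) \<and>
    disjoint_family_on (\<lambda>(i, j). atom P i j) (kr_ix P) \<and>
    \<Union>(kr_atoms P) = UNIV \<and>
    (\<forall>i\<in>cols P. \<forall>j. j + 1 < height P i \<longrightarrow> \<phi> ` atom P i j = atom P i (j + 1))"

definition kr_refines :: "'a kr \<Rightarrow> 'a kr \<Rightarrow> bool"
  where "kr_refines Q P \<longleftrightarrow>
    (\<forall>V\<in>kr_atoms Q. \<exists>U\<in>kr_atoms P. V \<subseteq> U) \<and> kr_base Q \<subseteq> kr_base P"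

definition kr_sequence ::
    "('a::topological_space \<Rightarrow> 'a) \<Rightarrow> 'a \<Rightarrow> (nat \<Rightarrow> 'a kr) \<Rightarrow> bool"
  where "kr_sequence \<phi> x \<A> \<longleftrightarrow>
    (\<forall>n. kr_partition \<phi> (\<A> n)) \<and>
    (\<forall>n. kr_refines (\<A> (Suc n)) (\<A> n)) \<and>
    (\<forall>C. open C \<and> closed C \<longrightarrow> (\<exists>N. \<forall>n\<ge>N. \<exists>S\<subseteq>kr_atoms (\<A> n). C = \<Union>S)) \<and>
    (\<Inter>n. kr_base (\<A> n)) = {x}"

definition kr_group :: "('a::topological_space \<Rightarrow> 'a) \<Rightarrow> 'a kr \<Rightarrow> ('a \<Rightarrow> 'a) set"
  where "kr_group \<phi> P = {g. homeo g \<and>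
    (\<forall>i\<in>cols P. \<forall>j<height P i. \<exists>k::int.
       0 \<le> int j + k \<and> int j + k < int (height P i) \<and> (\<forall>y\<in>atom P i j. g y = iter \<phi> k y))}"

(* For a minimal homeomorphism of the Cantor space a sequence as required exists, and the union
   does not depend on it, so the choice made by SOME is immaterial. *)
definition Gamma_group :: "('a::topological_space \<Rightarrow> 'a) \<Rightarrow> 'a \<Rightarrow> ('a \<Rightarrow> 'a) set"
  where "Gamma_group \<phi> x = (let \<A> = (SOME \<A>. kr_sequence \<phi> x \<A>) in \<Union>n. kr_group \<phi> (\<A> n))"

definition orbit_rel :: "('a \<Rightarrow> 'a) set \<Rightarrow> 'a \<Rightarrow> 'a \<Rightarrow> bool"
  where "orbit_rel G y y' \<longleftrightarrow> (\<exists>g\<in>G. y' = g y)"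

definition isomorphic_rel ::
    "('a::topological_space \<Rightarrow> 'a \<Rightarrow> bool) \<Rightarrow> ('a \<Rightarrow> 'a \<Rightarrow> bool) \<Rightarrow> bool"
  where "isomorphic_rel R S \<longleftrightarrow> (\<exists>g. homeo g \<and> (\<forall>y y'. R y y' \<longleftrightarrow> S (g y) (g y')))"

end

theory Submission
  imports Defs
begin

text \<open>
  The orbits of \<phi> and of \<open>\<Gamma>\<^sub>x\<close> differ only in that the orbit of x is cut, just before x, into two half
  orbits. This cut is absorbed as in Hilbert's hotel. Choose points \<open>x = x\<^sub>0, x\<^sub>1, \<dots>\<close> in distinct
  orbits that converge to a point in yet another orbit, let K be the set of these points and the
  limit, and cut the orbits before every point of K. If a homeomorphism g preserves the resulting
  relation and maps each \<open>x\<^sub>n\<close> to \<open>x\<^sub>n\<^sub>+\<^sub>1\<close> and the predecessor of \<open>x\<^sub>n\<close> to that of \<open>x\<^sub>n\<^sub>+\<^sub>1\<close>, it maps the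
  orbits of \<phi>, which arise by undoing all cuts, to those where all cuts but the one at x are
  undone. Such a g exists because the cut relation is an increasing union of relations with
  finite classes (the blocks between successive visits to small neighbourhoods of K), and for such
  a relation with dense classes every homeomorphism between closed sets meeting each class at most
  once extends to an automorphism, by a back-and-forth argument.
\<close>

section \<open>Increasing unions of finite equivalence relations\<close>

text \<open>Each orbit meets K at most once, so undoing the cut at d joins exactly two half orbits:
  the one that starts at d and the one that ends at the predecessor of d. What is joined is
  determined by these two points, so it suffices to prescribe g on K and on the predecessors of K.
  The extension argument needs K closed. For this reason the chosen points converge and their limit
  belongs to K; g fixes the limit and its predecessor.

  The obstacle in the back-and-forth is the passage to the limit, since a limit of elements of the
  full group need be neither bijective nor compatible with the relation. Both are secured by letting
  later elements differ from earlier ones, on either side, by automorphisms of a level, and by the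
  fact that the finite relations are closed.

  The blocks serve twice. For K = {x} they form a sequence of Kakutani--Rokhlin partitions, so the
  choice in \<open>Gamma_group\<close> is made from a nonempty set; every such sequence is then
  shown to have the orbits of \<phi> cut just before x.\<close>

text \<open>Two points with the same label at level m have classes of the same shape, and their classes
  correspond label by label. The labels of all levels generate the topology.\<close>

locale tower =
  fixes E :: "nat \<Rightarrow> 'a::topological_space \<Rightarrow> 'a \<Rightarrow> bool"
    and l :: "nat \<Rightarrow> 'a \<Rightarrow> 'b"
  assumes compact_UNIV: "compact (UNIV :: 'a set)"
    and open_iff: "\<And>V. open V \<longleftrightarrow> (\<forall>y\<in>V. \<exists>m. \<forall>z. l m z = l m y \<longrightarrow> z \<in> V)"
    and separated: "\<And>y z. (\<And>m. l m y = l m z) \<Longrightarrow> y = z"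
    and E_refl: "\<And>m y. E m y y"
    and E_sym: "\<And>m y z. E m y z \<Longrightarrow> E m z y"
    and E_trans: "\<And>m y z w. E m y z \<Longrightarrow> E m z w \<Longrightarrow> E m y w"
    and E_inj: "\<And>m y z. E m y z \<Longrightarrow> l m y = l m z \<Longrightarrow> y = z"
    and E_lift: "\<And>m y z y'. E m y z \<Longrightarrow> l m y = l m y' \<Longrightarrow> \<exists>z'. E m y' z' \<and> l m z' = l m z"
    and E_mono: "\<And>m m' y z. m \<le> m' \<Longrightarrow> E m y z \<Longrightarrow> E m' y z"
    and l_mono: "\<And>m m' y z. m \<le> m' \<Longrightarrow> l m' y = l m' z \<Longrightarrow> l m y = l m z"
    and E_det: "\<And>m m' y z y' z'. m \<le> m' \<Longrightarrow> E m y z \<Longrightarrow> E m' y' z' \<Longrightarrow>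
          l m' y = l m' y' \<Longrightarrow> l m' z = l m' z' \<Longrightarrow> E m y' z'"
    and l_0: "\<And>y z. l 0 y = l 0 z"
    and E_dense: "\<And>V. open V \<Longrightarrow> V \<noteq> {} \<Longrightarrow> \<exists>n. \<forall>y. \<exists>z\<in>V. E n y z"
begin

section \<open>The full group and the automorphisms of a level\<close>

definition tail_rel :: "'a \<Rightarrow> 'a \<Rightarrow> bool"
  where "tail_rel y z \<longleftrightarrow> (\<exists>m. E m y z)"

text \<open>The condition on labels takes the place of continuity of f and of its inverse, and
  staying in the class of one level expresses that only boundedly many displacements occur. In this
  form composition and inversion need no topology.\<close>

definition full_group :: "('a \<Rightarrow> 'a) set"
  where "full_group = {f. bij f \<and> (\<exists>M. \<forall>m\<ge>M.
    (\<forall>y. E m y (f y)) \<and> (\<forall>y z. l m (f y) = l m (f z) \<longleftrightarrow> l m y = l m z))}"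

text \<open>No continuity is asked here. These maps measure how far apart two elements of the full
  group are; the continuity of limits comes from the elements themselves.\<close>

definition Aut :: "nat \<Rightarrow> ('a \<Rightarrow> 'a) set"
  where "Aut m = {f. bij f \<and> (\<forall>y. l m (f y) = l m y) \<and> (\<forall>y z. E m (f y) (f z) \<longleftrightarrow> E m y z)}"

lemma tail_rel_sym: "tail_rel y z \<Longrightarrow> tail_rel z y"
  using E_sym tail_rel_def by blast

lemma tail_rel_trans: "tail_rel y z \<Longrightarrow> tail_rel z w \<Longrightarrow> tail_rel y w"
  unfolding tail_rel_def using E_trans E_mono[OF max.cobounded1] E_mono[OF max.cobounded2] by blast

text \<open>The lift made at level M does not leave the smaller class, because inside a class of
  level M the M-labels decide \<open>E m\<close>.\<close>

lemma E_lift_above: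
  assumes "m \<le> M" "E m y z" "l M y = l M y'"
  obtains z' where "E m y' z'" "l M z' = l M z"
proof -
  obtain z' where z': "E M y' z'" "l M z' = l M z"
    using E_lift[OF E_mono[OF assms(1,2)] assms(3)] by blast
  moreover have "E m y' z'"
    using E_det[OF assms(1,2) z'(1) assms(3)] z'(2) by simp
  ultimately show thesis using that by blast
qed

lemma open_label: "open {z. l m z = c}"
  unfolding open_iff by auto

text \<open>By compactness finitely many label classes, each with its own level, cover L; the
  maximum of these levels works because Q persists upwards.\<close>

lemma uniform_on_closed:
  assumes "closed L"
    and ev: "\<And>p. p \<in> L \<Longrightarrow> \<exists>M. \<forall>q\<in>L. l M q = l M p \<longrightarrow> Q M q"
    and mono: "\<And>M M' p. Q M p \<Longrightarrow> M \<le> M' \<Longrightarrow> Q M' p"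
  shows "\<exists>M. \<forall>M'\<ge>M. \<forall>p\<in>L. Q M' p"
proof -
  have "compact L"
    using compact_Int_closed[OF compact_UNIV \<open>closed L\<close>] by simp
  obtain N where N: "\<And>p q. p \<in> L \<Longrightarrow> q \<in> L \<Longrightarrow> l (N p) q = l (N p) p \<Longrightarrow> Q (N p) q"
    using ev by metis
  obtain F where F: "F \<subseteq> L" "finite F" "L \<subseteq> (\<Union>p\<in>F. {z. l (N p) z = l (N p) p})"
    by (rule compactE_image[OF \<open>compact L\<close>, of L "\<lambda>p. {z. l (N p) z = l (N p) p}"])
      (auto simp: open_label)
  have "Q M' p" if M': "Max (N ` F) \<le> M'" and p: "p \<in> L" for M' p
  proof -
    obtain q where q: "q \<in> F" "l (N q) p = l (N q) q" using F(3) p by blast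
    then have "Q (N q) p" using N F(1) p by blast
    moreover have "N q \<le> M'"
      using q(1) F(2) M' by (meson Max_ge finite_imageI imageI order_trans)
    ultimately show ?thesis using mono by blast
  qed
  then show ?thesis by blast
qed

lemma finite_labels: "finite (range (l m))"
proof -
  obtain F where F: "F \<subseteq> UNIV" "finite F" "UNIV \<subseteq> (\<Union>p\<in>F. {z. l m z = l m p})"
    by (rule compactE_image[OF compact_UNIV, of UNIV "\<lambda>p. {z. l m z = l m p}"])
      (auto simp: open_label)
  have "range (l m) \<subseteq> l m ` F" using F(3) by auto
  then show ?thesis using F(2) finite_surj by blast
qed

lemma finite_E_class: "finite {z. E m y z}"
proof (rule finite_imageD)
  show "finite (l m ` {z. E m y z})" by (rule finite_subset[OF _ finite_labels]) auto
  show "inj_on (l m) {z. E m y z}" 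
    by (rule inj_onI) (use E_inj[OF E_trans[OF E_sym]] in blast)
qed

text \<open>Density gives a level for each label of level m; there are finitely many labels and the
  classes grow with n, so the maximum serves all of them.\<close>

lemma uniformly_dense: "\<exists>N. \<forall>n\<ge>N. \<forall>y a. \<exists>z. E n y z \<and> l m z = l m a"
proof -
  have "\<exists>n. \<forall>y. \<exists>z. E n y z \<and> l m z = l m a" for a
    using E_dense[OF open_label[of m "l m a"]] by fastforce
  then obtain N where N: "\<And>a y. \<exists>z. E (N a) y z \<and> l m z = l m a" by metis
  obtain F where F: "finite F" "range (l m) = l m ` F"
    using finite_subset_image[OF finite_labels, of m "l m" UNIV] by auto
  have "\<exists>z. E n y z \<and> l m z = l m a" if "Max (N ` F) \<le> n" for n y a
  proof -
    obtain b where b: "b \<in> F" "l m a = l m b" using F(2) by blast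
    have "N b \<le> n" using b(1) F(1) that by (meson Max_ge finite_imageI imageI order_trans)
    then show ?thesis using N[of b y] b(2) E_mono[of "N b" n y] by metis
  qed
  then show ?thesis by blast
qed

text \<open>This is closedness of \<open>E m\<close> as a subset of the product. The class of y has
  only one point w with the m-label of z, so the lifts found for all higher M coincide with w. Hence
  w has every label of z and equals z.\<close>

lemma E_closed:
  assumes "\<And>M. m \<le> M \<Longrightarrow> \<exists>y' z'. l M y' = l M y \<and> l M z' = l M z \<and> E m y' z'"
  shows "E m y z"
proof -
  have *: "\<exists>w. E m y w \<and> l M w = l M z" if "m \<le> M" for M
    using assms[OF that] E_lift_above[OF that] by metis
  obtain w where w: "E m y w" "l m w = l m z" using *[OF order_refl] by blast
  have "l M w = l M z" if M: "m \<le> M" for M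
  proof -
    obtain v where v: "E m y v" "l M v = l M z" using *[OF M] by blast
    have "v = w" using E_inj[OF E_trans[OF E_sym[OF v(1)] w(1)]] w(2) l_mono[OF M v(2)] by simp
    then show ?thesis using v by simp
  qed
  then have "l M w = l M z" for M
    using l_mono[OF max.cobounded2[of M m], of w z] by simp
  then have "w = z" by (rule separated)
  then show ?thesis using w(1) by simp
qed

text \<open>A compactness argument: if each p disagreed with the sequence at some level, all points
  would disagree with it from a common level on, which fails for the point of the sequence at that
  level.\<close>

lemma ex_point:
  assumes "\<And>i j. i \<le> j \<Longrightarrow> l i (c j) = l i (c i)"
  shows "\<exists>z. \<forall>i. l i z = l i (c i)"
proof (rule ccontr)
  assume "\<not> ?thesis"
  then have *: "\<exists>i. l i z \<noteq> l i (c i)" for z by blast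
  have "\<exists>M. \<forall>M'\<ge>M. \<forall>p\<in>UNIV. l M' p \<noteq> l M' (c M')"
  proof (rule uniform_on_closed)
    show "\<exists>M. \<forall>q\<in>UNIV. l M q = l M p \<longrightarrow> l M q \<noteq> l M (c M)" for p using *[of p] by auto
    show "l M' p \<noteq> l M' (c M')" if "l M p \<noteq> l M (c M)" "M \<le> M'" for M M' p
      using that assms[of M M'] l_mono[of M M' p "c M'"] by auto
  qed simp
  then show False by blast
qed

lemma full_groupE:
  assumes "f \<in> full_group"
  obtains M where "\<And>m y. M \<le> m \<Longrightarrow> E m y (f y)"
    "\<And>m y z. M \<le> m \<Longrightarrow> l m (f y) = l m (f z) \<longleftrightarrow> l m y = l m z"
  using assms unfolding full_group_def by blast

lemma full_group_labels:
  assumes "f \<in> full_group"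
  shows "\<exists>M. \<forall>m\<ge>M. \<forall>y z. l m (f y) = l m (f z) \<longleftrightarrow> l m y = l m z"
  using assms unfolding full_group_def by blast

lemma full_group_bij: "f \<in> full_group \<Longrightarrow> bij f" unfolding full_group_def by blast

lemma full_group_tail_rel: assumes "f \<in> full_group" shows "tail_rel y (f y)"
  using assms unfolding full_group_def tail_rel_def by blast

lemma full_group_id: "id \<in> full_group"
  unfolding full_group_def using E_refl by auto

lemma full_group_comp:
  assumes "f \<in> full_group" "g \<in> full_group"
  shows "f \<circ> g \<in> full_group"
proof -
  obtain M where M: "\<And>m y. M \<le> m \<Longrightarrow> E m y (f y)"
    "\<And>m y z. M \<le> m \<Longrightarrow> l m (f y) = l m (f z) \<longleftrightarrow> l m y = l m z"
    using full_groupE[OF assms(1)] by blast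
  obtain N where N: "\<And>m y. N \<le> m \<Longrightarrow> E m y (g y)"
    "\<And>m y z. N \<le> m \<Longrightarrow> l m (g y) = l m (g z) \<longleftrightarrow> l m y = l m z"
    using full_groupE[OF assms(2)] by blast
  have "E m y ((f \<circ> g) y)" "l m ((f \<circ> g) y) = l m ((f \<circ> g) z) \<longleftrightarrow> l m y = l m z"
    if "max M N \<le> m" for m y z
    using that M(2) N(2) E_trans[OF N(1)[of m y] M(1)[of m "g y"]] by simp_all
  then show ?thesis unfolding full_group_def
    using bij_comp[OF full_group_bij[OF assms(2)] full_group_bij[OF assms(1)]] by blast
qed

lemma full_group_inv:
  assumes "f \<in> full_group"
  shows "inv f \<in> full_group"
proof -
  obtain M where M: "\<And>m y. M \<le> m \<Longrightarrow> E m y (f y)"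
    "\<And>m y z. M \<le> m \<Longrightarrow> l m (f y) = l m (f z) \<longleftrightarrow> l m y = l m z"
    using full_groupE[OF assms(1)] by blast
  have ff: "f (inv f y) = y" for y
    using full_group_bij[OF assms] by (simp add: bij_is_surj surj_f_inv_f)
  have "E m y (inv f y)" "l m (inv f y) = l m (inv f z) \<longleftrightarrow> l m y = l m z"
    if "M \<le> m" for m y z
    using that M(2)[of m "inv f y" "inv f z"] E_sym[OF M(1)[of m "inv f y"]] ff by simp_all
  then show ?thesis unfolding full_group_def
    using bij_imp_bij_inv[OF full_group_bij[OF assms]] by blast
qed

lemma Aut_id: "id \<in> Aut m" unfolding Aut_def by auto

lemma Aut_comp: "f \<in> Aut m \<Longrightarrow> g \<in> Aut m \<Longrightarrow> f \<circ> g \<in> Aut m"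
  unfolding Aut_def using bij_comp by auto

lemma Aut_bij: "f \<in> Aut m \<Longrightarrow> bij f" unfolding Aut_def by blast

lemma Aut_inv:
  assumes "f \<in> Aut m"
  shows "inv f \<in> Aut m"
proof -
  have ff: "f (inv f y) = y" for y
    using Aut_bij[OF assms] by (simp add: bij_is_surj surj_f_inv_f)
  have a: "l m (f y) = l m y" "E m (f y) (f z) \<longleftrightarrow> E m y z" for y z
    using assms unfolding Aut_def by auto
  have "l m (inv f y) = l m y" for y
    using a(1)[of "inv f y"] ff by simp
  moreover have "E m (inv f y) (inv f z) \<longleftrightarrow> E m y z" for y z
    using a(2)[of "inv f y" "inv f z"] ff by simp
  ultimately show ?thesis using bij_imp_bij_inv[OF Aut_bij[OF assms]] unfolding Aut_def by blast
qed

text \<open>Inside a class of level M the relation \<open>E m\<close> is read off the M-labels, so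
  preserving these labels and classes preserves \<open>E m\<close> as well.\<close>

lemma Aut_antimono:
  assumes "m \<le> M"
  shows "Aut M \<subseteq> Aut m"
proof
  fix f assume f: "f \<in> Aut M"
  have lM: "l M (f y) = l M y" and EM: "E M (f y) (f z) \<longleftrightarrow> E M y z" for y z
    using f unfolding Aut_def by auto
  have "E m (f y) (f z) \<longleftrightarrow> E m y z" for y z
    using E_det[OF assms, of y z "f y" "f z"] E_det[OF assms, of "f y" "f z" y z] lM EM E_mono[OF assms]
    by metis
  then show "f \<in> Aut m" using Aut_bij[OF f] l_mono[OF assms lM] unfolding Aut_def by blast
qed

text \<open>An element of the full group normalises the automorphisms of every sufficiently high level,
  because there it permutes the labels and keeps every point in its class.\<close>

lemma Aut_conj:
  assumes "f \<in> full_group"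
  shows "\<exists>M. \<forall>m\<ge>M. \<forall>\<alpha>\<in>Aut m. f \<circ> \<alpha> \<circ> inv f \<in> Aut m"
proof -
  obtain M where M: "\<And>m y. M \<le> m \<Longrightarrow> E m y (f y)"
    "\<And>m y z. M \<le> m \<Longrightarrow> l m (f y) = l m (f z) \<longleftrightarrow> l m y = l m z"
    using full_groupE[OF assms(1)] by blast
  have bf: "bij f" using full_group_bij[OF assms] .
  have ff: "f (inv f y) = y" for y
    using bf by (simp add: bij_is_surj surj_f_inv_f)
  have "f \<circ> \<alpha> \<circ> inv f \<in> Aut m" if m: "M \<le> m" and \<alpha>: "\<alpha> \<in> Aut m" for m \<alpha>
  proof -
    have a: "l m (\<alpha> y) = l m y" "E m (\<alpha> y) (\<alpha> z) \<longleftrightarrow> E m y z" for y z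
      using \<alpha> unfolding Aut_def by auto
    have "E m (f y) (f z) \<longleftrightarrow> E m y z" for y z
      using E_trans[OF M(1)[OF m, of y]] E_trans[OF _ E_sym[OF M(1)[OF m, of z]]]
        E_trans[OF E_sym[OF M(1)[OF m, of y]]] E_trans[OF _ M(1)[OF m, of z]] by blast
    then have "E m (f (\<alpha> (inv f y))) (f (\<alpha> (inv f z))) \<longleftrightarrow> E m y z" for y z
      using a(2)[of "inv f y" "inv f z"] ff by metis
    moreover have "l m (f (\<alpha> (inv f y))) = l m y" for y
      using M(2)[OF m, of "\<alpha> (inv f y)" "inv f y"] a ff by simp
    ultimately show ?thesis
      using bf Aut_bij[OF \<alpha>] unfolding Aut_def by (simp add: bij_comp bij_imp_bij_inv)
  qed
  then show ?thesis by blast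
qed

section \<open>Approximating a map on a sparse closed set\<close>

definition sparse :: "'a set \<Rightarrow> bool"
  where "sparse L \<longleftrightarrow> (\<forall>p\<in>L. \<forall>q\<in>L. tail_rel p q \<longrightarrow> p = q)"

definition label_cont_on :: "'a set \<Rightarrow> ('a \<Rightarrow> 'a) \<Rightarrow> bool"
  where "label_cont_on L k \<longleftrightarrow> (\<forall>p\<in>L. \<forall>m. \<exists>M. \<forall>q\<in>L. l M q = l M p \<longrightarrow> l m (k q) = l m (k p))"

lemma uniformly_label_cont:
  assumes "closed L" "label_cont_on L k"
  shows "\<exists>N. \<forall>M\<ge>N. \<forall>p\<in>L. \<forall>q\<in>L. l M q = l M p \<longrightarrow> l m (k q) = l m (k p)"
proof (rule uniform_on_closed[OF assms(1)])
  fix p assume p: "p \<in> L"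
  then obtain M where M: "\<And>q. q \<in> L \<Longrightarrow> l M q = l M p \<Longrightarrow> l m (k q) = l m (k p)"
    using assms(2) unfolding label_cont_on_def by blast
  then show "\<exists>M. \<forall>q\<in>L. l M q = l M p \<longrightarrow> (\<forall>r\<in>L. l M r = l M q \<longrightarrow> l m (k r) = l m (k q))"
    by (intro exI[of _ M]) auto
qed (use l_mono in blast)

text \<open>The class of p is finite, and by sparseness its other points lie outside the closed set
  L, so a high level separates them from L. Compactness makes this level independent of p.\<close>

lemma separate_from_orbit:
  assumes "closed L" "sparse L"
  shows "\<exists>N. \<forall>M\<ge>N. \<forall>p\<in>L. \<forall>z. E n p z \<and> z \<noteq> p \<longrightarrow> (\<forall>q\<in>L. l M q \<noteq> l M z)"
proof -
  let ?Q = "\<lambda>M p. n \<le> M \<and> (\<forall>z. E n p z \<and> z \<noteq> p \<longrightarrow> (\<forall>q\<in>L. l M q \<noteq> l M z))"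
  have "\<exists>N. \<forall>M\<ge>N. \<forall>p\<in>L. ?Q M p"
  proof (rule uniform_on_closed[OF assms(1)])
    fix p assume p: "p \<in> L"
    have "\<exists>N. \<forall>M\<ge>N. \<forall>q\<in>L. l M q \<noteq> l M z" if z: "E n p z" "z \<noteq> p" for z
    proof -
      have "z \<in> - L"
        using assms(2) p z unfolding sparse_def tail_rel_def by blast
      moreover have "open (- L)" using assms(1) by auto
      ultimately obtain N where "\<And>q. l N q = l N z \<Longrightarrow> q \<in> - L"
        unfolding open_iff by blast
      then show ?thesis using l_mono by (metis ComplD)
    qed
    then have "\<forall>z\<in>{z. E n p z} - {p}. \<exists>N. \<forall>M\<ge>N. \<forall>q\<in>L. l M q \<noteq> l M z" by blast
    then have "\<forall>z\<in>{z. E n p z} - {p}. eventually (\<lambda>M. \<forall>q\<in>L. l M q \<noteq> l M z) sequentially"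
      unfolding eventually_sequentially .
    then have "eventually (\<lambda>M. \<forall>z\<in>{z. E n p z} - {p}. \<forall>q\<in>L. l M q \<noteq> l M z) sequentially"
      by (rule eventually_ball_finite[OF finite_Diff[OF finite_E_class]])
    then obtain N where N: "\<And>M z q. N \<le> M \<Longrightarrow> E n p z \<Longrightarrow> z \<noteq> p \<Longrightarrow> q \<in> L \<Longrightarrow> l M q \<noteq> l M z"
      unfolding eventually_sequentially by blast
    \<comment> \<open>The level has to be at least n for \<open>E_lift_above\<close> to carry points
      of the class of p' over to the class of p.\<close>
    let ?M = "max n N"
    have "\<forall>p'\<in>L. l ?M p' = l ?M p \<longrightarrow> ?Q ?M p'"
    proof (intro ballI impI conjI allI)
      fix p' z q assume p': "p' \<in> L" "l ?M p' = l ?M p" and z: "E n p' z \<and> z \<noteq> p'" and q: "q \<in> L"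
      obtain w where w: "E n p w" "l ?M w = l ?M z"
        using E_lift_above[of n ?M p' z p] z p'(2) by auto
      have "w \<noteq> p"
      proof
        assume "w = p"
        then have "l n z = l n p'" using w(2) p'(2) l_mono[of n ?M z p'] by simp
        then show False using E_inj[of n p' z] z by simp
      qed
      then show "l ?M q \<noteq> l ?M z" using N[of ?M w q] w q by simp
    qed simp
    then show "\<exists>M. \<forall>p'\<in>L. l M p' = l M p \<longrightarrow> ?Q M p'" by blast
  next
    fix M M' p assume Q: "?Q M p" and M': "M \<le> M'"
    show "?Q M' p"
    proof (intro conjI allI impI ballI)
      show "n \<le> M'" using Q M' by simp
      fix z q assume "E n p z \<and> z \<noteq> p" "q \<in> L"
      then have "l M q \<noteq> l M z" using Q by blast
      then show "l M' q \<noteq> l M' z" using l_mono[OF M'] by blast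
    qed
  qed
  then show ?thesis by blast
qed

text \<open>The required element exchanges, inside each class of a high level n, the class of level m0
  through a point of L with one through a point whose label at level m is the prescribed one.
  Since L is sparse, no two of these exchanges interfere.\<close>

lemma approximate_by_Aut:
  assumes L: "closed L" "sparse L" and k: "label_cont_on L k" and m: "m0 \<le> m"
    and k0: "\<And>p. p \<in> L \<Longrightarrow> l m0 (k p) = l m0 p"
  obtains \<delta> where "\<delta> \<in> full_group" "\<delta> \<in> Aut m0" "\<And>p. p \<in> L \<Longrightarrow> l m (\<delta> p) = l m (k p)"
proof -
  \<comment> \<open>Classes of level n contain every label of level m, so the label prescribed by k
    can be reached without leaving the class of p.\<close>
  obtain n where nm: "m \<le> n" and dense: "\<And>y a. \<exists>z. E n y z \<and> l m z = l m a"
    using uniformly_dense[of m] by (meson nat_le_linear)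
  obtain N1 where N1: "\<And>M p q. N1 \<le> M \<Longrightarrow> p \<in> L \<Longrightarrow> q \<in> L \<Longrightarrow> l M q = l M p \<Longrightarrow> l m (k q) = l m (k p)"
    using uniformly_label_cont[OF L(1) k] by blast
  obtain N2 where N2: "\<And>M p q z. N2 \<le> M \<Longrightarrow> p \<in> L \<Longrightarrow> E n p z \<Longrightarrow> z \<noteq> p \<Longrightarrow> q \<in> L \<Longrightarrow> l M q \<noteq> l M z"
    using separate_from_orbit[OF L] by blast
  \<comment> \<open>At level M the label of a point of L fixes the m-label of its image under k, and
    within its class of level n no other point has an M-label that occurs on L.\<close>
  define M where "M = max n (max N1 N2)"
  have NM: "N1 \<le> M" "N2 \<le> M" and nM: "n \<le> M" and m0n: "m0 \<le> n" and m0M: "m0 \<le> M" and mM: "m \<le> M"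
    using nm m unfolding M_def by auto
  have near: "l m (k q) = l m (k p)" if prem: "p \<in> L" "q \<in> L" "l M q = l M p" for p q
    using N1[OF NM(1)] prem by blast
  have isolated: "z = p" if prem: "p \<in> L" "q \<in> L" "E n p z" "l M q = l M z" for p q z
    using N2[OF NM(2)] prem by blast
  define D where "D = l M ` L"
  \<comment> \<open>One representative per M-label is enough: by \<open>near\<close>, k prescribes
    the same m-label on all points of L that share the M-label.\<close>
  define rp where "rp d = (SOME p. p \<in> L \<and> l M p = d)" for d
  have rp: "rp d \<in> L" "l M (rp d) = d" if prem: "d \<in> D" for d
    using someI_ex[of "\<lambda>p. p \<in> L \<and> l M p = d"] prem unfolding rp_def D_def by auto
  define w where "w d = (SOME z. E n (rp d) z \<and> l m z = l m (k (rp d)))" for d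
  have w: "E n (rp d) (w d)" "l m (w d) = l m (k (rp d))" for d
    using someI_ex[OF dense[of "rp d" "k (rp d)"]] unfolding w_def by auto
  define t where "t d = l M (w d)" for d
  \<comment> \<open>A class of level n has at most one point whose M-label occurs on L; lifting to
    the class of the representative reduces this to \<open>isolated\<close>.\<close>
  have F1: "u = v" if prem: "d \<in> D" "c \<in> D" "E n u v" "l M u = d" "l M v = c" for d c u v
  proof -
    obtain v' where v': "E n (rp d) v'" "l M v' = l M v"
      using E_lift_above[OF nM prem(3), of "rp d"] rp(2)[OF prem(1)] prem(4) by auto
    have "v' = rp d" using isolated[OF rp(1)[OF prem(1)] rp(1)[OF prem(2)] v'(1)] v'(2) rp(2) prem by simp
    then have "l n u = l n v" using l_mono[OF nM, of u v] v'(2) rp(2) prem by simp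
    then show "u = v" using E_inj[OF prem(3)] by blast
  qed
  have lw: "l m0 (w d) = l m0 (rp d)" if prem: "d \<in> D" for d
    using l_mono[OF m w(2)] k0[OF rp(1)[OF prem]] by simp
  have F2: "\<exists>u'. E n u u' \<and> l M u' = t d \<and> l m0 u' = l m0 u" if prem: "d \<in> D" "l M u = d" for d u
  proof -
    obtain u' where u': "E n u u'" "l M u' = l M (w d)"
      using E_lift_above[OF nM w(1)[of d], of u] rp(2)[OF prem(1)] prem(2) by auto
    have "l m0 u' = l m0 u"
      using l_mono[OF m0M u'(2)] l_mono[OF m0M, of u "rp d"] lw[OF prem(1)] rp(2)[OF prem(1)] prem(2) by simp
    then show ?thesis using u' unfolding t_def by blast
  qed
  have F3: "\<exists>u. E n u' u \<and> l M u = d \<and> l m0 u = l m0 u'" if prem: "d \<in> D" "l M u' = t d" for d u'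
  proof -
    obtain u where u: "E n u' u" "l M u = l M (rp d)"
      using E_lift_above[OF nM E_sym[OF w(1)[of d]], of u'] prem(2) unfolding t_def by auto
    have "l m0 u = l m0 u'"
      using l_mono[OF m0M u(2)] l_mono[OF m0M, of u' "w d"] lw[OF prem(1)] prem(2) unfolding t_def by simp
    then show ?thesis using u rp(2)[OF prem(1)] by auto
  qed
  define A where "A d y \<longleftrightarrow> d \<in> D \<and> (\<exists>u. E m0 y u \<and> l M u = d)" for d y
  define B where "B d y \<longleftrightarrow> d \<in> D \<and> (\<exists>u. E m0 y u \<and> l M u = t d)" for d y
  \<comment> \<open>The exchange is first a relation that matches points of equal m0-label. The two
    classes have the same shape because points labelled d and \<open>t d\<close> share their
    m0-label, by \<open>lw\<close> and the hypothesis on k. If the two classes coincide, it is the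
    identity on them.\<close>
  define \<Delta> where "\<Delta> y z \<longleftrightarrow> E n y z \<and> l m0 y = l m0 z \<and>
    ((\<exists>d. A d y \<and> B d z) \<or> (\<exists>d. B d y \<and> A d z) \<or> (y = z \<and> (\<forall>d. \<not> A d y \<and> \<not> B d y)))" for y z
  have E0n: "E m0 y z \<Longrightarrow> E n y z" for y z using E_mono[OF m0n] .
  have A_E: "A d y \<longleftrightarrow> A d z" and B_E: "B d y \<longleftrightarrow> B d z" if prem: "E m0 y z" for d y z
    using prem E_sym E_trans unfolding A_def B_def by blast+
  have AA: "d = c \<and> E m0 y z" if prem: "A d y" "A c z" "E n y z" for d c y z
  proof -
    obtain u v where u: "E m0 y u" "l M u = d" "d \<in> D" and v: "E m0 z v" "l M v = c" "c \<in> D"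
      using prem unfolding A_def by blast
    have "E n u v" using E_trans[OF E_trans[OF E_sym[OF E0n[OF u(1)]] prem(3)] E0n[OF v(1)]] .
    then have "u = v" using F1 u v by blast
    then show ?thesis using u v E_trans[OF u(1) E_sym] by blast
  qed
  have BB: "E m0 y z" if prem: "B d y" "B d z" "E n y z" for d y z
  proof -
    obtain u v where u: "E m0 y u" "l M u = t d" and v: "E m0 z v" "l M v = t d"
      using prem unfolding B_def by blast
    have "E n u v" using E_trans[OF E_trans[OF E_sym[OF E0n[OF u(1)]] prem(3)] E0n[OF v(1)]] .
    moreover have "l n u = l n v" using l_mono[OF nM, of u v] u v by simp
    ultimately have "u = v" using E_inj by blast
    then show ?thesis using u v E_trans[OF u(1) E_sym] by blast
  qed
  have A_of_B: "\<exists>a. A d a \<and> E n y a" if prem: "B d y" for d y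
  proof -
    obtain u where u: "E m0 y u" "l M u = t d" "d \<in> D" using prem unfolding B_def by blast
    obtain v where "E n u v" "l M v = d" using F3[OF u(3,2)] by blast
    then show ?thesis using u E_refl E_trans[OF E0n[OF u(1)]] unfolding A_def by blast
  qed
  \<comment> \<open>Different exchanges never meet in one class of level n: beside each class marked
    by B lies one marked by A with the same index, and the latter is unique by
    \<open>AA\<close>.\<close>
  have dd: "d = c" if prem: "A d y \<or> B d y" "A c z \<or> B c z" "E n y z" for d c y z
  proof -
    obtain a where a: "A d a" "E n y a" using prem(1) A_of_B E_refl by blast
    obtain b where b: "A c b" "E n z b" using prem(2) A_of_B E_refl by blast
    show ?thesis using AA[OF a(1) b(1)] E_trans[OF E_trans[OF E_sym[OF a(2)] prem(3)] b(2)] by blast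
  qed
  have fixed: "E m0 y z" if prem: "A d y" "B d y" "A d z \<or> B d z" "E n y z" for d y z
    using prem AA BB by blast
  have inj0: "y = z" if prem: "E m0 y z" "l m0 y = l m0 z" for y z using E_inj prem by blast
  have \<Delta>_sym: "\<Delta> z y" if prem: "\<Delta> y z" for y z
    using prem E_sym unfolding \<Delta>_def by auto
  have \<Delta>_total: "\<exists>z. \<Delta> y z" for y
  proof -
    consider d where "A d y" | d where "B d y" | "\<forall>d. \<not> A d y \<and> \<not> B d y" by blast
    then show ?thesis
    proof cases
      case 1
      then obtain u where u: "E m0 y u" "l M u = d" "d \<in> D" unfolding A_def by blast
      obtain u' where u': "E n u u'" "l M u' = t d" "l m0 u' = l m0 u" using F2[OF u(3,2)] by blast
      obtain z where z: "E m0 u' z" "l m0 z = l m0 y" using E_lift[OF E_sym[OF u(1)] u'(3)[symmetric]] by blast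
      have "B d z" using u(3) u'(2) E_sym[OF z(1)] unfolding B_def by blast
      moreover have "E n y z" using E_trans[OF E_trans[OF E0n[OF u(1)] u'(1)] E0n[OF z(1)]] .
      ultimately show ?thesis using 1 z(2) unfolding \<Delta>_def by auto
    next
      case 2
      then obtain u where u: "E m0 y u" "l M u = t d" "d \<in> D" unfolding B_def by blast
      obtain u' where u': "E n u u'" "l M u' = d" "l m0 u' = l m0 u" using F3[OF u(3,2)] by blast
      obtain z where z: "E m0 u' z" "l m0 z = l m0 y" using E_lift[OF E_sym[OF u(1)] u'(3)[symmetric]] by blast
      have "A d z" using u(3) u'(2) E_sym[OF z(1)] unfolding A_def by blast
      moreover have "E n y z" using E_trans[OF E_trans[OF E0n[OF u(1)] u'(1)] E0n[OF z(1)]] .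
      ultimately show ?thesis using 2 z(2) unfolding \<Delta>_def by auto
    next
      case 3
      then show ?thesis using E_refl unfolding \<Delta>_def by blast
    qed
  qed
  have \<Delta>_unique: "z = z'" if z: "\<Delta> y z" and z': "\<Delta> y z'" for y z z'
  proof -
    have E: "E n y z" "E n y z'" "E n z z'" and lab: "l m0 z = l m0 z'" "l m0 y = l m0 z" "l m0 y = l m0 z'"
      using z z' E_trans[OF E_sym] unfolding \<Delta>_def by (blast, blast, blast, auto)
    consider d c where "A d y" "B d z" "A c y" "B c z'" | d c where "A d y" "B d z" "B c y" "A c z'"
      | d c where "B d y" "A d z" "A c y" "B c z'" | d c where "B d y" "A d z" "B c y" "A c z'"
      | "y = z" "y = z'"
      using z z' unfolding \<Delta>_def by blast
    then show ?thesis
    proof cases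
      case 1
      have "d = c" using dd[OF _ _ E_refl] 1 by blast
      then show ?thesis using inj0[OF BB[OF _ _ E(3)] lab(1)] 1 by blast
    next
      case 2
      have "d = c" using dd[OF _ _ E_refl] 2 by blast
      then show ?thesis using inj0[OF fixed[OF _ _ _ E(1)] lab(2)] inj0[OF fixed[OF _ _ _ E(2)] lab(3)] 2 by blast
    next
      case 3
      have "d = c" using dd[OF _ _ E_refl] 3 by blast
      then show ?thesis using inj0[OF fixed[OF _ _ _ E(1)] lab(2)] inj0[OF fixed[OF _ _ _ E(2)] lab(3)] 3 by blast
    next
      case 4
      then show ?thesis using inj0[OF _ lab(1)] AA[OF _ _ E(3)] by blast
    next
      case 5
      then show ?thesis by simp
    qed
  qed
  obtain \<delta> where \<delta>: "\<And>y. \<Delta> y (\<delta> y)" using choice[of \<Delta>] \<Delta>_total by blast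
  have \<delta>_eq: "\<delta> y = z" if prem: "\<Delta> y z" for y z using \<Delta>_unique[OF \<delta> prem] .
  have \<delta>\<delta>: "\<delta> (\<delta> y) = y" for y using \<delta>_eq[OF \<Delta>_sym[OF \<delta>]] .
  have bij: "bij \<delta>" by (rule o_bij[of \<delta>]) (auto simp: \<delta>\<delta>)
  have l\<delta>: "l m0 (\<delta> y) = l m0 y" for y using \<delta>[of y] unfolding \<Delta>_def by simp
  have En\<delta>: "E n y (\<delta> y)" for y using \<delta>[of y] unfolding \<Delta>_def by simp
  have E\<delta>: "E m0 (\<delta> y) (\<delta> y')" if prem: "E m0 y y'" for y y'
  proof -
    obtain z' where z': "E m0 (\<delta> y) z'" "l m0 z' = l m0 y'"
      using E_lift[OF prem l\<delta>[symmetric]] by blast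
    have "E n y' z'" using E_trans[OF E_trans[OF E0n[OF E_sym[OF prem]] En\<delta>] E0n[OF z'(1)]] .
    moreover have "y' = z'" if prem: "\<delta> y = y"
      using inj0[of y' z'] E_trans[OF E_sym[OF \<open>E m0 y y'\<close>], of z'] z' prem by simp
    ultimately have "\<Delta> y' z'"
      using \<delta>[of y] z'(2) A_E[OF prem] B_E[OF prem] A_E[OF z'(1)] B_E[OF z'(1)] unfolding \<Delta>_def by metis
    then show ?thesis using \<delta>_eq z'(1) by blast
  qed
  have "E m0 (\<delta> y) (\<delta> z) \<longleftrightarrow> E m0 y z" for y z using E\<delta>[of y z] E\<delta>[of "\<delta> y" "\<delta> z"] \<delta>\<delta> by auto
  then have "\<delta> \<in> Aut m0" using bij l\<delta> unfolding Aut_def by blast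
  moreover have "\<delta> \<in> full_group"
  proof -
    \<comment> \<open>From level M on, the label of a point decides which exchange concerns it.
      Lifting the pair (y, \<delta> y) to y' gives a pair related by \<Delta>, and uniqueness
      identifies its second member with \<delta> y'.\<close>
    have l_imp: "l i (\<delta> y) = l i (\<delta> y')" if i: "M \<le> i" and yy': "l i y = l i y'" for i y y'
    proof -
      have m0i: "m0 \<le> i" and ni: "n \<le> i" using m0M nM i by auto
      have A_lab: "A d a \<longrightarrow> A d b" and B_lab: "B d a \<longrightarrow> B d b" if prem: "l i a = l i b" for d a b
        using E_lift_above[OF m0i _ prem] l_mono[OF i] unfolding A_def B_def by metis+
      obtain z' where z': "E n y' z'" "l i z' = l i (\<delta> y)"
        using E_lift_above[OF ni En\<delta> yy'] by blast
      have "l m0 y' = l m0 z'" using l_mono[OF m0i z'(2)] l_mono[OF m0i yy'] l\<delta>[of y] by simp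
      moreover have "y' = z'" if prem: "\<delta> y = y"
        using E_inj[OF E_mono[OF ni z'(1)]] z'(2) yy' prem by simp
      ultimately have "\<Delta> y' z'"
        using z' \<delta>[of y] A_lab[OF yy'] B_lab[OF yy'] A_lab[OF z'(2)[symmetric]] B_lab[OF z'(2)[symmetric]]
          A_lab[OF yy'[symmetric]] B_lab[OF yy'[symmetric]] unfolding \<Delta>_def by metis
      then show ?thesis using \<delta>_eq z'(2) by metis
    qed
    have "l i (\<delta> y) = l i (\<delta> y') \<longleftrightarrow> l i y = l i y'" if prem: "M \<le> i" for i y y'
      using l_imp[OF prem, of y y'] l_imp[OF prem, of "\<delta> y" "\<delta> y'"] \<delta>\<delta> by auto
    moreover have "E i y (\<delta> y)" if prem: "M \<le> i" for i y using E_mono[OF _ En\<delta>] nM prem by simp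
    ultimately show ?thesis unfolding full_group_def using bij by blast
  qed
  moreover have "l m (\<delta> p) = l m (k p)" if p: "p \<in> L" for p
  proof -
    have d: "l M p \<in> D" using p unfolding D_def by blast
    obtain z where z: "E n p z" "l M z = t (l M p)" "l m0 z = l m0 p"
      using F2[OF d refl] by blast
    have "A (l M p) p" "B (l M p) z" using d z E_refl unfolding A_def B_def by blast+
    then have "\<Delta> p z" using z unfolding \<Delta>_def by auto
    then have "l m (\<delta> p) = l m (w (l M p))" using \<delta>_eq l_mono[OF mM] z(2) unfolding t_def by blast
    also have "\<dots> = l m (k p)" using w(2) near[OF rp(1)[OF d] p] rp(2)[OF d] by simp
    finally show ?thesis .
  qed
  ultimately show thesis using that by blast
qed

subsection \<open>Homeomorphisms between sparse closed sets\<close>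

lemma label_cont_on_full_group_comp:
  assumes "f \<in> full_group" "label_cont_on L k"
  shows "label_cont_on L (f \<circ> k)"
  unfolding label_cont_on_def
proof (intro ballI allI)
  fix p m assume p: "p \<in> L"
  obtain N where "\<forall>m\<ge>N. \<forall>y z. l m (f y) = l m (f z) \<longleftrightarrow> l m y = l m z"
    using full_group_labels[OF assms(1)] by (rule exE)
  note N = this[rule_format]
  obtain M where M: "\<forall>q\<in>L. l M q = l M p \<longrightarrow> l (max m N) (k q) = l (max m N) (k p)"
    using assms(2) p unfolding label_cont_on_def by blast
  have "l m (f (k q)) = l m (f (k p))" if "q \<in> L" "l M q = l M p" for q
    using N[OF max.cobounded2[of N m], of "k q" "k p"] M that
      l_mono[OF max.cobounded1[of m N], of "f (k q)" "f (k p)"] by blast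
  then have "\<forall>q\<in>L. l M q = l M p \<longrightarrow> l m ((f \<circ> k) q) = l m ((f \<circ> k) p)" by simp
  then show "\<exists>M. \<forall>q\<in>L. l M q = l M p \<longrightarrow> l m ((f \<circ> k) q) = l m ((f \<circ> k) p)" by blast
qed

text \<open>One round of the back-and-forth: f is composed with an element that brings it closer to h on L,
  and the result with one that brings its inverse closer to h' on the image of L.\<close>

lemma refine_step:
  assumes f: "f \<in> full_group"
    and L: "closed L" "sparse L" "closed (h ` L)" "sparse (h ` L)"
    and h: "label_cont_on L h" "label_cont_on (h ` L) h'" "\<And>p. p \<in> L \<Longrightarrow> h' (h p) = p"
    and fh: "\<And>p. p \<in> L \<Longrightarrow> l m0 (inv f (h p)) = l m0 p"
  obtains f' m' where "f' \<in> full_group" "m0 \<le> m'" "n \<le> m'"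
    "\<And>p. p \<in> L \<Longrightarrow> l m' (inv f' (h p)) = l m' p"
    "inv f \<circ> f' \<in> Aut m0" "\<And>\<alpha>. \<alpha> \<in> Aut m' \<Longrightarrow> f' \<circ> \<alpha> \<circ> inv f' \<in> Aut n"
proof -
  have ff: "f (inv f y) = y" "inv f (f y) = y" for y
    using full_group_bij[OF f] by (simp_all add: bij_is_surj surj_f_inv_f bij_is_inj)
  obtain N1 where "\<forall>m\<ge>N1. \<forall>y z. l m (f y) = l m (f z) \<longleftrightarrow> l m y = l m z"
    using full_group_labels[OF f] by (rule exE)
  note N1 = this[rule_format]
  obtain N2 where "\<forall>m\<ge>N2. \<forall>\<alpha>\<in>Aut m. inv f \<circ> \<alpha> \<circ> inv (inv f) \<in> Aut m"
    using Aut_conj[OF full_group_inv[OF f]] by (rule exE)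
  note N2 = this[rule_format]
  \<comment> \<open>Above \<open>N1\<close> the map f respects labels, which turns agreement of a
    with \<open>inv f \<circ> h\<close> into agreement of g with h. Above \<open>N2\<close>
    conjugation by \<open>inv f\<close> keeps the later correction b inside
    \<open>Aut m\<close>.\<close>
  define m where "m = Max {m0, n, N1, N2}"
  have m: "m0 \<le> m" "n \<le> m" "N1 \<le> m" "N2 \<le> m" unfolding m_def by auto
  have k: "label_cont_on L (inv f \<circ> h)" using label_cont_on_full_group_comp[OF full_group_inv[OF f] h(1)] .
  have fh': "l m0 ((inv f \<circ> h) p) = l m0 p" if "p \<in> L" for p using fh[OF that] by simp
  obtain a where a: "a \<in> full_group" "a \<in> Aut m0" "\<And>p. p \<in> L \<Longrightarrow> l m (a p) = l m ((inv f \<circ> h) p)"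
    using approximate_by_Aut[OF L(1,2) k m(1) fh'] by blast
  define g where "g = f \<circ> a"
  have g: "g \<in> full_group" unfolding g_def using full_group_comp[OF f a(1)] .
  have gg: "g (inv g y) = y" "inv g (g y) = y" for y
    using full_group_bij[OF g] by (simp_all add: bij_is_surj surj_f_inv_f bij_is_inj)
  have gh: "l m (g p) = l m (h p)" if "p \<in> L" for p
    using N1[OF m(3), of "a p" "inv f (h p)"] a(3)[OF that] ff unfolding g_def by simp
  obtain N3 where "\<forall>m\<ge>N3. \<forall>y z. l m (g y) = l m (g z) \<longleftrightarrow> l m y = l m z"
    using full_group_labels[OF g] by (rule exE)
  note N3 = this[rule_format]
  obtain N4 where "\<forall>m\<ge>N4. \<forall>\<alpha>\<in>Aut m. g \<circ> \<alpha> \<circ> inv g \<in> Aut m"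
    using Aut_conj[OF g] by (rule exE)
  note N4 = this[rule_format]
  define m' where "m' = Max {m, N3, N4}"
  have m': "m \<le> m'" "N3 \<le> m'" "N4 \<le> m'" unfolding m'_def by auto
  have gh': "l m ((g \<circ> h') q) = l m q" if "q \<in> h ` L" for q
    using that gh h(3) by auto
  \<comment> \<open>The map \<open>g \<circ> h'\<close> takes h p to g p, which by \<open>gh\<close>
    already has the m-label of h p; hence the correction on the range side can be chosen in
    \<open>Aut m\<close>.\<close>
  obtain c where c: "c \<in> full_group" "c \<in> Aut m" "\<And>q. q \<in> h ` L \<Longrightarrow> l m' (c q) = l m' ((g \<circ> h') q)"
    using approximate_by_Aut[OF L(3,4) label_cont_on_full_group_comp[OF g h(2)] m'(1) gh'] by blast
  have cc: "c (inv c y) = y" "inv c (c y) = y" for y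
    using full_group_bij[OF c(1)] by (simp_all add: bij_is_surj surj_f_inv_f bij_is_inj)
  define b where "b = inv c"
  have b: "b \<in> Aut m" unfolding b_def using Aut_inv[OF c(2)] .
  define f' where "f' = b \<circ> g"
  have f': "f' \<in> full_group" unfolding f'_def b_def using full_group_comp[OF full_group_inv[OF c(1)] g] .
  have inv_f': "inv f' = inv g \<circ> c"
    by (rule inv_unique_comp) (auto simp: f'_def b_def cc gg)
  have "l m' (inv f' (h p)) = l m' p" if "p \<in> L" for p
    using N3[OF m'(2), of "inv g (c (h p))" p] c(3)[of "h p"] h(3)[OF that] that gg
    unfolding inv_f' by simp
  moreover have "inv f \<circ> f' \<in> Aut m0"
  proof -
    have "inv f \<circ> b \<circ> inv (inv f) \<in> Aut m0" using N2[OF m(4) b] Aut_antimono[OF m(1)] by blast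
    then have "(inv f \<circ> b \<circ> f) \<circ> a \<in> Aut m0"
      using Aut_comp[OF _ a(2)] inv_inv_eq[OF full_group_bij[OF f]] by simp
    then show ?thesis unfolding f'_def g_def by (simp add: comp_assoc)
  qed
  moreover have "f' \<circ> \<alpha> \<circ> inv f' \<in> Aut n" if "\<alpha> \<in> Aut m'" for \<alpha>
  proof -
    have "g \<circ> \<alpha> \<circ> inv g \<in> Aut m" using N4[OF m'(3) that] Aut_antimono[OF m'(1)] by blast
    then have "b \<circ> (g \<circ> \<alpha> \<circ> inv g) \<circ> c \<in> Aut m" using Aut_comp b c(2) by blast
    moreover have "b \<circ> (g \<circ> \<alpha> \<circ> inv g) \<circ> c = f' \<circ> \<alpha> \<circ> inv f'"
      unfolding inv_f' unfolding f'_def by (simp add: comp_assoc)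
    ultimately show ?thesis using Aut_antimono[OF m(2)] by auto
  qed
  moreover have "m0 \<le> m'" "n \<le> m'" using m m' by auto
  ultimately show thesis using that f' by blast
qed

section \<open>Limits of elements of the full group\<close>

text \<open>The later approximations differ from f j by automorphisms of level j, so
  \<open>inv (f j) \<circ> f k\<close> preserves \<open>E j\<close>, and closedness of
  \<open>E j\<close> passes this on to the limit. The map \<open>inv (f j)\<close> is then dropped,
  because it moves points inside their tail classes.\<close>

lemma tail_rel_limit:
  assumes f: "\<And>i. f i \<in> full_group"
    and A: "\<And>i j. i \<le> j \<Longrightarrow> inv (f i) \<circ> f j \<in> Aut i"
    and g: "\<And>i y. l i (g y) = l i (f i y)"
    and yz: "tail_rel y z"
  shows "tail_rel (g y) (g z)"
proof -
  obtain j where j: "E j y z" using yz unfolding tail_rel_def by blast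
  obtain N where "\<forall>m\<ge>N. \<forall>u v. l m (inv (f j) u) = l m (inv (f j) v) \<longleftrightarrow> l m u = l m v"
    using full_group_labels[OF full_group_inv[OF f[of j]]] by (rule exE)
  note N = this[rule_format]
  have "E j (inv (f j) (g y)) (inv (f j) (g z))"
  proof (rule E_closed)
    fix M assume "j \<le> M"
    let ?k = "max N M"
    have "E j (inv (f j) (f ?k y)) (inv (f j) (f ?k z))"
      using A[of j ?k] j \<open>j \<le> M\<close> unfolding Aut_def by auto
    moreover have "l M (inv (f j) (f ?k u)) = l M (inv (f j) (g u))" for u
      using N[OF max.cobounded1, of M "f ?k u" "g u"] g[of ?k u]
        l_mono[OF max.cobounded2[of M N], of "inv (f j) (f ?k u)" "inv (f j) (g u)"] by argo
    ultimately show "\<exists>y' z'. l M y' = l M (inv (f j) (g y)) \<and> l M z' = l M (inv (f j) (g z)) \<and> E j y' z'"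
      by blast
  qed
  then have "tail_rel (inv (f j) (g y)) (inv (f j) (g z))" unfolding tail_rel_def by blast
  then show ?thesis
    using tail_rel_trans[OF tail_rel_trans[OF full_group_tail_rel[OF full_group_inv[OF f[of j]]]] tail_rel_sym[OF full_group_tail_rel[OF full_group_inv[OF f[of j]]]]] by blast
qed

text \<open>Condition B makes the maps converge and condition A their inverses. The limit has at
  level m the label given by f m, a single element of the full group, and continuity follows from
  this.\<close>

lemma homeo_limit:
  assumes f: "\<And>i. f i \<in> full_group"
    and A: "\<And>i j. i \<le> j \<Longrightarrow> inv (f i) \<circ> f j \<in> Aut i"
    and B: "\<And>i j. i \<le> j \<Longrightarrow> f j \<circ> inv (f i) \<in> Aut i"
  obtains g g' where "homeomorphism UNIV UNIV g g'"
    "\<And>i y. l i (g' y) = l i (inv (f i) y)" "\<And>y z. tail_rel (g y) (g z) \<longleftrightarrow> tail_rel y z"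
proof -
  have ff: "f i (inv (f i) y) = y" "inv (f i) (f i y) = y" for i y
    using full_group_bij[OF f] by (simp_all add: bij_is_surj surj_f_inv_f bij_is_inj)
  have inv_f: "inv (inv (f i)) = f i" for i using inv_inv_eq[OF full_group_bij[OF f]] .
  have A': "inv (f j) \<circ> f i \<in> Aut i" and B': "f i \<circ> inv (f j) \<in> Aut i" if "i \<le> j" for i j
    using Aut_inv[OF A[OF that]] Aut_inv[OF B[OF that]]
    by (simp_all add: o_inv_distrib full_group_bij[OF f] bij_imp_bij_inv full_group_bij[OF full_group_inv[OF f]] inv_f)
  have lab: "l i (f j y) = l i (f i y)" "l i (inv (f j) y) = l i (inv (f i) y)"
    "l i (f i (inv (f j) y)) = l i y" "l i (inv (f i) (f j y)) = l i y" if ij: "i \<le> j" for i j y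
  proof -
    have *: "l i (\<alpha> z) = l i z" if "\<alpha> \<in> Aut i" for \<alpha> z using that unfolding Aut_def by blast
    show "l i (f j y) = l i (f i y)" using *[OF B[OF ij], of "f i y"] ff by simp
    show "l i (inv (f j) y) = l i (inv (f i) y)" using *[OF A'[OF ij], of "inv (f i) y"] ff by simp
    show "l i (f i (inv (f j) y)) = l i y" using *[OF B'[OF ij]] by simp
    show "l i (inv (f i) (f j y)) = l i y" using *[OF A[OF ij]] by simp
  qed
  have "\<exists>z. \<forall>i. l i z = l i (f i y)" for y by (rule ex_point) (rule lab(1))
  then obtain g where g: "\<And>i y. l i (g y) = l i (f i y)" by metis
  have "\<exists>z. \<forall>i. l i z = l i (inv (f i) y)" for y by (rule ex_point) (rule lab(2))
  then obtain g' where g': "\<And>i y. l i (g' y) = l i (inv (f i) y)" by metis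
  \<comment> \<open>Here u is the limit of the points c i. Since F respects all high labels, F u
    agrees with F (c k) for large k; this shows that the two limit maps are inverse to each
    other.\<close>
  have transfer: "l j (F u) = x" if F: "F \<in> full_group" and uv: "\<And>i. l i u = l i (c i)"
    "\<And>k. j \<le> k \<Longrightarrow> l j (F (c k)) = x" for F u x c j
  proof -
    obtain N where "\<forall>m\<ge>N. \<forall>y z. l m (F y) = l m (F z) \<longleftrightarrow> l m y = l m z"
      using full_group_labels[OF F] by (rule exE)
    note N = this[rule_format]
    have "l (max j N) (F u) = l (max j N) (F (c (max j N)))"
      using N[OF max.cobounded2[of N j]] uv(1) by blast
    then have "l j (F u) = l j (F (c (max j N)))" by (rule l_mono[OF max.cobounded1])
    then show ?thesis using uv(2)[OF max.cobounded1] by simp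
  qed
  have "l j (g (g' y)) = l j y" for j y
    using transfer[OF f[of j] g' lab(3)] g[of j "g' y"] by simp
  then have gg': "g (g' y) = y" for y by (rule separated)
  have "l j (g' (g y)) = l j y" for j y
    using transfer[OF full_group_inv[OF f[of j]] g lab(4)] g'[of j "g y"] by simp
  then have g'g: "g' (g y) = y" for y by (rule separated)
  have cont: "continuous_on UNIV G" if F: "\<And>i. F i \<in> full_group" and G: "\<And>i y. l i (G y) = l i (F i y)" for F G
  proof -
    have "open (G -` V)" if V: "open V" for V
      unfolding open_iff
    proof
      fix y assume "y \<in> G -` V"
      then obtain m where m: "\<And>z. l m z = l m (G y) \<Longrightarrow> z \<in> V" using V unfolding open_iff by blast
      obtain M where "\<forall>i\<ge>M. \<forall>y z. l i (F m y) = l i (F m z) \<longleftrightarrow> l i y = l i z"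
        using full_group_labels[OF F[of m]] by (rule exE)
      note M = this[rule_format]
      have "z \<in> G -` V" if "l (max m M) z = l (max m M) y" for z
      proof -
        have "l m (F m z) = l m (F m y)"
          using M[OF max.cobounded2[of M m], of z y] that l_mono[OF max.cobounded1[of m M], of "F m z" "F m y"] by blast
        then show ?thesis using m[of "G z"] G by simp
      qed
      then show "\<exists>m. \<forall>z. l m z = l m y \<longrightarrow> z \<in> G -` V" by blast
    qed
    then show ?thesis using continuous_on_open_vimage[OF open_UNIV, of G] by auto
  qed
  have "homeomorphism UNIV UNIV g g'"
    by (rule homeomorphismI) (auto simp: gg' g'g intro: cont[OF f g] cont[OF full_group_inv[OF f] g'])
  moreover have "tail_rel (g y) (g z) \<longleftrightarrow> tail_rel y z" for y z
    using tail_rel_limit[OF f A g, of y z] tail_rel_limit[where f = "\<lambda>i. inv (f i)" and g = g', OF full_group_inv[OF f] _ g', of "g y" "g z"] B' g'g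
    by (auto simp: inv_f)
  ultimately show thesis using that g' by blast
qed

theorem extend_homeomorphism:
  assumes L: "closed L" "sparse L" "closed (h ` L)" "sparse (h ` L)"
    and h: "label_cont_on L h" "label_cont_on (h ` L) h'" "\<And>p. p \<in> L \<Longrightarrow> h' (h p) = p"
  obtains g where "homeo g" "\<And>p. p \<in> L \<Longrightarrow> g p = h p" "\<And>y z. tail_rel (g y) (g z) \<longleftrightarrow> tail_rel y z"
proof -
  \<comment> \<open>A state pairs an element with a level, which may run ahead of the stage i
    because conjugation loses levels. The last clause turns closeness of the inverses (A) into
    closeness of the maps themselves (B).\<close>
  define P where "P i s \<longleftrightarrow> fst s \<in> full_group \<and> i \<le> snd s \<and> (\<forall>p\<in>L. l (snd s) (inv (fst s) (h p)) = l (snd s) p) \<and>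
    (\<forall>\<alpha>\<in>Aut (snd s). fst s \<circ> \<alpha> \<circ> inv (fst s) \<in> Aut i)" for i :: nat and s :: "('a \<Rightarrow> 'a) \<times> nat"
  define R where "R s s' \<longleftrightarrow> snd s \<le> snd s' \<and> inv (fst s) \<circ> fst s' \<in> Aut (snd s)" for s s' :: "('a \<Rightarrow> 'a) \<times> nat"
  have "\<exists>\<sigma>. \<forall>i. P i (\<sigma> i) \<and> R (\<sigma> i) (\<sigma> (Suc i))"
  proof (rule dependent_nat_choice)
    \<comment> \<open>There is only one label of level 0, so the identity agrees with h
      there.\<close>
    show "\<exists>s. P 0 s" unfolding P_def using full_group_id l_0 by (intro exI[of _ "(id, 0)"]) auto
    fix s i assume s: "P i s"
    obtain f' m' where "f' \<in> full_group" "snd s \<le> m'" "Suc i \<le> m'"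
      "\<And>p. p \<in> L \<Longrightarrow> l m' (inv f' (h p)) = l m' p"
      "inv (fst s) \<circ> f' \<in> Aut (snd s)" "\<And>\<alpha>. \<alpha> \<in> Aut m' \<Longrightarrow> f' \<circ> \<alpha> \<circ> inv f' \<in> Aut (Suc i)"
      using refine_step[OF _ L h, of "fst s" "snd s" "Suc i"] s unfolding P_def by auto
    then show "\<exists>s'. P (Suc i) s' \<and> R s s'"
      unfolding P_def R_def by (intro exI[of _ "(f', m')"]) auto
  qed
  then obtain \<sigma> where \<sigma>: "\<And>i. P i (\<sigma> i)" "\<And>i. R (\<sigma> i) (\<sigma> (Suc i))" by blast
  define f where "f i = fst (\<sigma> i)" for i
  define m where "m i = snd (\<sigma> i)" for i
  have f: "f i \<in> full_group" and m: "i \<le> m i" and fh: "\<And>p. p \<in> L \<Longrightarrow> l (m i) (inv (f i) (h p)) = l (m i) p"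
    and conj: "\<And>\<alpha>. \<alpha> \<in> Aut (m i) \<Longrightarrow> f i \<circ> \<alpha> \<circ> inv (f i) \<in> Aut i" for i
    using \<sigma>(1)[of i] unfolding P_def f_def m_def by auto
  have ff: "f i (inv (f i) y) = y" for i y
    using full_group_bij[OF f] by (simp add: bij_is_surj surj_f_inv_f)
  have mSuc: "m i \<le> m (Suc i)" and fSuc: "inv (f i) \<circ> f (Suc i) \<in> Aut (m i)" for i
    using \<sigma>(2)[of i] unfolding R_def f_def m_def by auto
  have m_mono: "m i \<le> m j" if "i \<le> j" for i j
    using lift_Suc_mono_le[of m, OF mSuc that] .
  have A: "inv (f i) \<circ> f j \<in> Aut (m i)" if "i \<le> j" for i j
    using that
  proof (induction j rule: dec_induct)
    case base
    have "inv (f i) \<circ> f i = id" using full_group_bij[OF f] by (simp add: bij_is_inj)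
    then show ?case using Aut_id by metis
  next
    case (step j)
    have "inv (f j) \<circ> f (Suc j) \<in> Aut (m i)"
      using fSuc Aut_antimono[OF m_mono[OF step(1)]] by blast
    then have "(inv (f i) \<circ> f j) \<circ> (inv (f j) \<circ> f (Suc j)) \<in> Aut (m i)"
      using Aut_comp step.IH by blast
    moreover have "(inv (f i) \<circ> f j) \<circ> (inv (f j) \<circ> f (Suc j)) = inv (f i) \<circ> f (Suc j)"
      by (auto simp: ff)
    ultimately show ?case by metis
  qed
  have B: "f j \<circ> inv (f i) \<in> Aut i" if "i \<le> j" for i j
  proof -
    have "f i \<circ> (inv (f i) \<circ> f j) \<circ> inv (f i) = f j \<circ> inv (f i)" by (auto simp: ff)
    then show ?thesis using conj[OF A[OF that]] by simp
  qed
  have A': "inv (f i) \<circ> f j \<in> Aut i" if "i \<le> j" for i j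
    using A[OF that] Aut_antimono[OF m] by blast
  obtain g g' where g: "homeomorphism UNIV UNIV g g'"
    "\<And>i y. l i (g' y) = l i (inv (f i) y)" "\<And>y z. tail_rel (g y) (g z) \<longleftrightarrow> tail_rel y z"
    using homeo_limit[of f, OF f A' B] by blast
  have "g p = h p" if "p \<in> L" for p
  proof -
    have "l i (g' (h p)) = l i p" for i using g(2) l_mono[OF m fh[OF that]] by simp
    then have "g' (h p) = p" by (rule separated)
    then show ?thesis using homeomorphism_apply2[OF g(1), of "h p"] by simp
  qed
  then show thesis using that g unfolding homeo_def by blast
qed

end

section \<open>Orbits cut at a closed set\<close>

lemma iter_0 [simp]: "iter f 0 y = y"
  unfolding iter_def by simp

lemma iter_1 [simp]: "iter f 1 y = f y"
  unfolding iter_def by simp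

lemma iter_Suc:
  assumes "bij f"
  shows "iter f (k + 1) y = f (iter f k y)"
proof (cases "0 \<le> k")
  case True
  then show ?thesis unfolding iter_def by (simp add: nat_add_distrib)
next
  case False
  then obtain n where k: "k = - int (Suc n)"
    using negD[of k] by auto
  have "iter f (k + 1) y = (inv f ^^ n) y"
    unfolding iter_def k by (auto simp: nat_diff_distrib)
  also have "\<dots> = f (inv f ((inv f ^^ n) y))"
    using assms by (simp add: bij_is_surj surj_f_inv_f)
  also have "\<dots> = f (iter f k y)" unfolding iter_def k by (simp add: nat_add_distrib)
  finally show ?thesis .
qed

lemma iter_pred:
  assumes "bij f"
  shows "iter f (k - 1) y = inv f (iter f k y)"
  using iter_Suc[OF assms, of "k - 1" y] assms by (simp add: bij_is_inj)

lemma iter_iter: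
  assumes "bij f"
  shows "iter f j (iter f k y) = iter f (j + k) y"
proof (induction j rule: int_induct[where k = 0])
  case base
  show ?case by simp
next
  case (step1 i)
  then show ?case using iter_Suc[OF assms, of i "iter f k y"] iter_Suc[OF assms, of "i + k" y]
    by (simp add: algebra_simps)
next
  case (step2 i)
  then show ?case using iter_pred[OF assms, of i "iter f k y"] iter_pred[OF assms, of "i + k" y]
    by (simp add: algebra_simps)
qed

text \<open>A cut at a point c lies between c and its predecessor, so the way from y to its k-th iterate
  passes the cuts at the i-th iterates with i in the following set.\<close>

definition crossed :: "int \<Rightarrow> int set"
  where "crossed k = {0<..k} \<union> {k<..0}"

definition cut_rel :: "('a \<Rightarrow> 'a) \<Rightarrow> 'a set \<Rightarrow> 'a \<Rightarrow> 'a \<Rightarrow> bool"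
  where "cut_rel f K y z \<longleftrightarrow> (\<exists>k. z = iter f k y \<and> (\<forall>i\<in>crossed k. iter f i y \<notin> K))"

lemma crossed_0 [simp]: "crossed 0 = {}" unfolding crossed_def by auto

lemma crossed_add: "i \<in> crossed (j + k) \<Longrightarrow> i \<in> crossed k \<or> i - k \<in> crossed j"
  unfolding crossed_def by auto

lemma crossed_shift: "i \<in> crossed j \<Longrightarrow> i + k \<in> crossed (j + k) \<or> i + k \<in> crossed k"
  unfolding crossed_def by auto

lemma cut_rel_sym:
  assumes "bij f" "cut_rel f K y z"
  shows "cut_rel f K z y"
proof -
  obtain k where k: "z = iter f k y" "\<forall>i\<in>crossed k. iter f i y \<notin> K"
    using assms(2) unfolding cut_rel_def by blast
  have "y = iter f (- k) z" using k(1) iter_iter[OF assms(1)] by simp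
  moreover have "iter f i z \<notin> K" if "i \<in> crossed (- k)" for i
    using crossed_shift[OF that, of k] k iter_iter[OF assms(1)] by auto
  ultimately show ?thesis unfolding cut_rel_def by blast
qed

lemma cut_rel_trans:
  assumes "bij f" "cut_rel f K y z" "cut_rel f K z w"
  shows "cut_rel f K y w"
proof -
  obtain k where k: "z = iter f k y" "\<forall>i\<in>crossed k. iter f i y \<notin> K"
    using assms(2) unfolding cut_rel_def by blast
  obtain j where j: "w = iter f j z" "\<forall>i\<in>crossed j. iter f i z \<notin> K"
    using assms(3) unfolding cut_rel_def by blast
  have "w = iter f (j + k) y" using j k iter_iter[OF assms(1)] by simp
  moreover have "iter f i y \<notin> K" if i: "i \<in> crossed (j + k)" for i
    using crossed_add[OF i]
  proof
    assume "i - k \<in> crossed j"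
    then have "iter f (i - k) z \<notin> K" using j by blast
    then show ?thesis using k(1) iter_iter[OF assms(1)] by simp
  qed (use k in blast)
  ultimately show ?thesis unfolding cut_rel_def by blast
qed

section \<open>Minimal systems on the Cantor space\<close>

text \<open>The Cantor space enters through compactness, uncountability and an enumeration C of its
  clopen sets. The whole space has index 0, so that membership in \<open>C 0\<close> is a vacuous
  test at every level.\<close>

locale cantor_dyn =
  fixes \<phi> :: "'a::topological_space \<Rightarrow> 'a" and C :: "nat \<Rightarrow> 'a set"
  assumes comp: "compact (UNIV :: 'a set)"
    and uncountable: "uncountable (UNIV :: 'a set)"
    and bij: "bij \<phi>"
    and cont: "continuous_on UNIV \<phi>" "continuous_on UNIV (inv \<phi>)"
    and C_clopen: "open (C i)" "closed (C i)"
    and C_all: "open V \<Longrightarrow> closed V \<Longrightarrow> \<exists>i. V = C i"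
    and C_0: "C 0 = UNIV"
    and C_base: "open V \<Longrightarrow> y \<in> V \<Longrightarrow> \<exists>i. y \<in> C i \<and> C i \<subseteq> V"
    and C_separates: "y \<noteq> z \<Longrightarrow> \<exists>i. y \<in> C i \<and> z \<notin> C i"
    and minimal: "open V \<Longrightarrow> V \<noteq> {} \<Longrightarrow> \<exists>k. iter \<phi> k y \<in> V"
begin

lemmas iter_add = iter_iter[OF bij]

lemma cont_iter: "continuous_on UNIV (iter \<phi> k)"
proof -
  have "continuous_on UNIV (f ^^ n)" if "continuous_on UNIV f" for f :: "'a \<Rightarrow> 'a" and n
    by (induction n) (auto intro: continuous_on_compose2[OF that] simp: continuous_on_id' id_def)
  then show ?thesis unfolding iter_def using cont by auto
qed

lemma open_iter_vimage: "open V \<Longrightarrow> open {y. iter \<phi> k y \<in> V}"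
  using continuous_on_open_vimage[OF open_UNIV, of "iter \<phi> k"] cont_iter by (auto simp: vimage_def)

lemma closed_iter_vimage: "closed V \<Longrightarrow> closed {y. iter \<phi> k y \<in> V}"
  using continuous_on_closed_vimage[OF closed_UNIV, of "iter \<phi> k"] cont_iter by (auto simp: vimage_def)

lemma closed_singleton: "closed {y :: 'a}"
proof -
  have "- {y} = (\<Union>i\<in>{i. y \<notin> C i}. C i)" using C_separates by auto
  then have "open (- {y})" using C_clopen by auto
  then show ?thesis by (simp add: closed_def)
qed

lemma closed_finite: "finite F \<Longrightarrow> closed (F :: 'a set)"
  using closed_UN[of F "\<lambda>y. {y}"] closed_singleton by simp

text \<open>A periodic orbit is finite, hence closed, hence by minimality the whole space, which is
  uncountable.\<close>

lemma free:
  assumes "iter \<phi> k y = y"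
  shows "k = 0"
proof (rule ccontr)
  assume k: "k \<noteq> 0"
  define n where "n = \<bar>k\<bar>"
  have "iter \<phi> (- k) y = y" using assms iter_add[of "- k" k y] by simp
  then have n: "iter \<phi> n y = y" "0 < n" using assms k unfolding n_def by (auto simp: abs_if)
  have mult: "iter \<phi> (n * int a) z = z" if "iter \<phi> n z = z" for a z
    by (induction a) (auto simp: algebra_simps that simp flip: iter_add)
  have "iter \<phi> i y \<in> (\<lambda>j. iter \<phi> j y) ` {0..<n}" for i
  proof -
    have "iter \<phi> i y = iter \<phi> (i mod n) y"
    proof -
      have "iter \<phi> (n * q) y = y" for q
      proof (cases "0 \<le> q")
        case True then show ?thesis using mult[OF n(1), of "nat q"] by simp
      next
        case False
        then have "iter \<phi> (n * (- q)) y = y" using mult[OF n(1), of "nat (- q)"] by simp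
        then show ?thesis using iter_add[of "n * q" "n * (- q)" y] by simp
      qed
      then show ?thesis using iter_add[of "i mod n" "n * (i div n)" y] by simp
    qed
    then show ?thesis using n(2) by auto
  qed
  then have fin: "finite (range (\<lambda>i. iter \<phi> i y))"
    using finite_subset[of "range (\<lambda>i. iter \<phi> i y)" "(\<lambda>j. iter \<phi> j y) ` {0..<n}"] by auto
  have "open (- range (\<lambda>i. iter \<phi> i y))" using closed_finite[OF fin] by auto
  then have "- range (\<lambda>i. iter \<phi> i y) = {}" using minimal[of _ y] by blast
  then have "finite (UNIV :: 'a set)" using fin by (metis Compl_empty_eq double_complement)
  then show False using uncountable countable_finite by blast
qed

lemma return_times:
  assumes "open V" "V \<noteq> {}"
  obtains N :: int where "0 < N" "\<And>y. \<exists>k\<in>{0<..N}. iter \<phi> k y \<in> V" "\<And>y. \<exists>k\<in>{-N..0}. iter \<phi> k y \<in> V"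
proof -
  obtain F where F: "F \<subseteq> UNIV" "finite F" "UNIV \<subseteq> (\<Union>k\<in>F. {y. iter \<phi> k y \<in> V})"
    by (rule compactE_image[OF comp, of UNIV "\<lambda>k. {y. iter \<phi> k y \<in> V}"])
      (use open_iter_vimage[OF assms(1)] minimal[OF assms] in auto)
  \<comment> \<open>All hitting times of the finite cover lie between -n and n. Starting n + 1 steps
    later makes them positive, starting n steps earlier makes them nonpositive.\<close>
  define n where "n = Max (insert 0 (abs ` F))"
  have n: "0 \<le> n" "\<And>k. k \<in> F \<Longrightarrow> \<bar>k\<bar> \<le> n" unfolding n_def using F(2) by auto
  have "\<exists>k\<in>{0<..2*n+1}. iter \<phi> k y \<in> V" for y
  proof -
    obtain k where k: "k \<in> F" "iter \<phi> k (iter \<phi> (n + 1) y) \<in> V" using F(3) by blast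
    then have "iter \<phi> (k + (n + 1)) y \<in> V" using iter_add by simp
    moreover have "k + (n + 1) \<in> {0<..2*n+1}" using n(2)[OF k(1)] by auto
    ultimately show ?thesis by blast
  qed
  moreover have "\<exists>k\<in>{-(2*n+1)..0}. iter \<phi> k y \<in> V" for y
  proof -
    obtain k where k: "k \<in> F" "iter \<phi> k (iter \<phi> (- n) y) \<in> V" using F(3) by blast
    then have "iter \<phi> (k + (- n)) y \<in> V" using iter_add by simp
    moreover have "k + (- n) \<in> {-(2*n+1)..0}" using n(1) n(2)[OF k(1)] by auto
    ultimately show ?thesis by blast
  qed
  ultimately show thesis using that[of "2 * n + 1"] n(1) by auto
qed

lemma decreasing_closed_empty:
  fixes W :: "nat \<Rightarrow> 'a set"
  assumes "\<And>n. closed (W n)" "\<And>m n. m \<le> n \<Longrightarrow> W n \<subseteq> W m" "(\<Inter>n. W n) = {}"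
  shows "\<exists>N. \<forall>n\<ge>N. W n = {}"
proof -
  obtain F where F: "F \<subseteq> UNIV" "finite F" "UNIV \<subseteq> (\<Union>n\<in>F. - W n)"
    by (rule compactE_image[OF comp, of UNIV "\<lambda>n. - W n"]) (use assms in auto)
  have "W n = {}" if n: "Max F \<le> n" for n
  proof (rule equals0I)
    fix y assume y: "y \<in> W n"
    obtain m where m: "m \<in> F" "y \<notin> W m" using F(3) by blast
    then have "m \<le> n" using n F(2) Max_ge order_trans by blast
    then show False using assms(2) y m by blast
  qed
  then show ?thesis by blast
qed

end

section \<open>Finite blocks between visits to neighbourhoods of K\<close>

locale cut_dyn = cantor_dyn \<phi> C for \<phi> :: "'a::topological_space \<Rightarrow> 'a" and C +
  fixes K :: "'a set"
  assumes K_closed: "closed K" and K_nonempty: "K \<noteq> {}"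
    and K_sparse: "y \<in> K \<Longrightarrow> iter \<phi> k y \<in> K \<Longrightarrow> k = 0"
begin

text \<open>These sets decrease to K, because every clopen set containing K occurs in the
  enumeration.\<close>

definition B :: "nat \<Rightarrow> 'a set"
  where "B m = {y. \<forall>i\<le>m. K \<subseteq> C i \<longrightarrow> y \<in> C i}"

text \<open>The positions, relative to y, of the block of y when all orbits are cut before each
  visit to \<open>B m\<close>.\<close>

definition J :: "nat \<Rightarrow> 'a \<Rightarrow> int set"
  where "J m y = {k. \<forall>i\<in>crossed k. iter \<phi> i y \<notin> B m}"

definition E :: "nat \<Rightarrow> 'a \<Rightarrow> 'a \<Rightarrow> bool"
  where "E m y z \<longleftrightarrow> (\<exists>k\<in>J m y. z = iter \<phi> k y)"

text \<open>The label is the whole block as seen from y, with the trace of the first clopen sets on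
  it, so moving along the block just translates it. The entries with i = 0 record the block
  itself.\<close>

definition l :: "nat \<Rightarrow> 'a \<Rightarrow> (int \<times> nat) set"
  where "l m y = {(k, i). k \<in> J m y \<and> i \<le> m \<and> iter \<phi> k y \<in> C i}"

lemma B_clopen: "open (B m)" "closed (B m)"
proof -
  have "B m = (\<Inter>i\<in>{i\<in>{..m}. K \<subseteq> C i}. C i)" unfolding B_def by auto
  then show "open (B m)" "closed (B m)" using C_clopen by (auto intro!: open_INT closed_INT)
qed

lemma K_B: "K \<subseteq> B m" unfolding B_def by auto

lemma B_nonempty: "B m \<noteq> {}" using K_B K_nonempty by blast

lemma B_antimono: "m \<le> n \<Longrightarrow> B n \<subseteq> B m" unfolding B_def by auto

lemma B_eventually: "y \<notin> K \<Longrightarrow> \<exists>N. \<forall>n\<ge>N. y \<notin> B n"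
proof -
  assume "y \<notin> K"
  moreover have "open (- K)" using K_closed by auto
  ultimately obtain i where i: "y \<in> C i" "C i \<subseteq> - K" using C_base[of "- K" y] by auto
  obtain j where j: "- C i = C j" using C_all[of "- C i"] C_clopen by auto
  then have "y \<notin> B n" if "j \<le> n" for n using i that unfolding B_def by blast
  then show ?thesis by blast
qed

lemma B_0: "B 0 = UNIV" unfolding B_def using C_0 by auto

lemma J_0 [simp]: "0 \<in> J m y" unfolding J_def by simp

lemma J_antimono: "m \<le> n \<Longrightarrow> J m y \<subseteq> J n y"
  unfolding J_def using B_antimono by blast

lemma J_shift:
  assumes "k \<in> J m y"
  shows "j \<in> J m (iter \<phi> k y) \<longleftrightarrow> j + k \<in> J m y"
proof
  assume j: "j \<in> J m (iter \<phi> k y)"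
  have "iter \<phi> i y \<notin> B m" if i: "i \<in> crossed (j + k)" for i
    using crossed_add[OF i]
  proof
    assume "i - k \<in> crossed j"
    then have "iter \<phi> (i - k) (iter \<phi> k y) \<notin> B m" using j unfolding J_def by blast
    then show ?thesis using iter_add by simp
  qed (use assms J_def in blast)
  then show "j + k \<in> J m y" unfolding J_def by blast
next
  assume jk: "j + k \<in> J m y"
  have "iter \<phi> i (iter \<phi> k y) \<notin> B m" if i: "i \<in> crossed j" for i
    using crossed_shift[OF i, of k] jk assms iter_add unfolding J_def by auto
  then show "j \<in> J m (iter \<phi> k y)" unfolding J_def by blast
qed

lemma J_label: "k \<in> J m y \<longleftrightarrow> (k, 0) \<in> l m y"
  unfolding l_def using C_0 by simp

lemma label_shift:
  assumes "k \<in> J m y"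
  shows "l m (iter \<phi> k y) = {(j, i). (j + k, i) \<in> l m y}"
  unfolding l_def using J_shift[OF assms] iter_add by auto

lemma label_C: "i \<le> m \<Longrightarrow> l m y = l m z \<Longrightarrow> y \<in> C i \<longleftrightarrow> z \<in> C i"
proof -
  assume i: "i \<le> m" and lab: "l m y = l m z"
  have "u \<in> C i \<longleftrightarrow> (0, i) \<in> l m u" for u using i unfolding l_def by simp
  then show ?thesis using lab by simp
qed

lemma label_B:
  assumes "m \<le> n" "l n y = l n z"
  shows "y \<in> B m \<longleftrightarrow> z \<in> B m"
  unfolding B_def using label_C[OF _ assms(2)] assms(1) by simp

text \<open>Blocks end at visits to \<open>B m\<close>, and these recur within bounded time in both
  directions.\<close>

lemma J_bound: "\<exists>N. \<forall>y. \<forall>k\<in>J m y. \<bar>k\<bar> \<le> N"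
proof -
  obtain N where N: "0 < N" "\<And>y. \<exists>k\<in>{0<..N}. iter \<phi> k y \<in> B m" "\<And>y. \<exists>k\<in>{-N..0}. iter \<phi> k y \<in> B m"
    using return_times[OF B_clopen(1) B_nonempty] by blast
  have "\<bar>k\<bar> \<le> N" if k: "k \<in> J m y" for y k
  proof (rule ccontr)
    assume "\<not> \<bar>k\<bar> \<le> N"
    then consider "N < k" | "k < - N" by linarith
    then show False
    proof cases
      case 1
      obtain i where "i \<in> {0<..N}" "iter \<phi> i y \<in> B m" using N(2) by blast
      moreover then have "i \<in> crossed k" using 1 unfolding crossed_def by auto
      ultimately show False using k unfolding J_def by blast
    next
      case 2
      obtain i where "i \<in> {-N..0}" "iter \<phi> i y \<in> B m" using N(3) by blast
      moreover then have "i \<in> crossed k" using 2 unfolding crossed_def by auto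
      ultimately show False using k unfolding J_def by blast
    qed
  qed
  then show ?thesis by blast
qed

text \<open>Blocks of one level are uniformly bounded, so a label is the answer to finitely many
  questions, each decided by a clopen set.\<close>

lemma open_label_class: "open {z. l m z = l m y}"
proof -
  obtain N where N: "\<And>y k. k \<in> J m y \<Longrightarrow> \<bar>k\<bar> \<le> N" using J_bound by blast
  have mem: "open {z. (k, i) \<in> l m z}" "closed {z. (k, i) \<in> l m z}" for k i
  proof -
    have "{z. (k, i) \<in> l m z} =
      (if i \<le> m then (\<Inter>j\<in>crossed k. {z. iter \<phi> j z \<in> - B m}) \<inter> {z. iter \<phi> k z \<in> C i} else {})"
      unfolding l_def J_def by auto
    moreover have "finite (crossed k)" unfolding crossed_def by simp
    ultimately show "open {z. (k, i) \<in> l m z}" "closed {z. (k, i) \<in> l m z}"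
      using B_clopen[of m] C_clopen[of i]
      by (auto intro!: open_Int closed_Int open_INT closed_INT open_iter_vimage closed_iter_vimage
          simp: Compl_eq[symmetric] simp del: ComplD Compl_iff)
  qed
  let ?F = "{-N..N} \<times> {..m}"
  have sub: "l m z \<subseteq> ?F" for z
  proof
    fix x assume "x \<in> l m z"
    then obtain k i where x: "x = (k, i)" "k \<in> J m z" "i \<le> m" unfolding l_def by auto
    then show "x \<in> ?F" using N[OF x(2)] by auto
  qed
  have "{z. l m z = l m y} = (\<Inter>x\<in>?F. {z. x \<in> l m z \<longleftrightarrow> x \<in> l m y})"
    using sub by blast
  moreover have "open {z. x \<in> l m z \<longleftrightarrow> x \<in> l m y}" for x
  proof (cases "x \<in> l m y")
    case True
    then show ?thesis using mem(1)[of "fst x" "snd x"] by simp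
  next
    case False
    have "open (- {z. x \<in> l m z})" using mem(2)[of "fst x" "snd x"] by (simp add: open_Compl)
    then show ?thesis using False by (simp add: Collect_neg_eq)
  qed
  ultimately show ?thesis by (auto intro!: open_INT)
qed

text \<open>For fixed d the points of \<open>B m\<close> that are again in \<open>B m\<close> after
  d steps form closed sets decreasing to the empty set, because K meets each orbit at most once. By
  compactness they are empty at a finite level, and only finitely many d are concerned.\<close>

lemma no_two_cuts:
  fixes N :: int
  shows "\<exists>n. \<forall>m\<ge>n. \<forall>d\<in>{1..N}. \<forall>y\<in>B m. iter \<phi> d y \<notin> B m"
proof -
  have "\<exists>n. \<forall>m\<ge>n. \<forall>y\<in>B m. iter \<phi> d y \<notin> B m" if d: "d \<in> {1..N}" for d
  proof -
    let ?W = "\<lambda>m. B m \<inter> {y. iter \<phi> d y \<in> B m}"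
    have "\<exists>n. \<forall>m\<ge>n. ?W m = {}"
    proof (rule decreasing_closed_empty)
      show "closed (?W m)" for m using B_clopen closed_iter_vimage by blast
      show "?W n \<subseteq> ?W m" if "m \<le> n" for m n using B_antimono[OF that] by blast
      show "(\<Inter>m. ?W m) = {}"
      proof (rule equals0I)
        fix y assume "y \<in> (\<Inter>m. ?W m)"
        then have "y \<in> K" "iter \<phi> d y \<in> K" using B_eventually by blast+
        then show False using K_sparse d by fastforce
      qed
    qed
    then show ?thesis by blast
  qed
  then have "\<forall>d\<in>{1..N}. eventually (\<lambda>m. \<forall>y\<in>B m. iter \<phi> d y \<notin> B m) sequentially"
    unfolding eventually_sequentially by blast
  then have "eventually (\<lambda>m. \<forall>d\<in>{1..N}. \<forall>y\<in>B m. iter \<phi> d y \<notin> B m) sequentially"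
    by (rule eventually_ball_finite[OF finite_atLeastAtMost_int])
  then show ?thesis unfolding eventually_sequentially .
qed

text \<open>Visits to \<open>B n\<close> are more than 2N steps apart. If one lies among the last N
  positions, none follows in the next N and V is reached going forwards; otherwise V is reached
  going backwards.\<close>

lemma E_visits:
  assumes "open V" "V \<noteq> {}"
  shows "\<exists>n. \<forall>y. \<exists>z\<in>V. E n y z"
proof -
  obtain N where N: "0 < N" "\<And>y. \<exists>k\<in>{0<..N}. iter \<phi> k y \<in> V" "\<And>y. \<exists>k\<in>{-N..0}. iter \<phi> k y \<in> V"
    using return_times[OF assms] by blast
  obtain n where n: "\<And>d y. d \<in> {1..2*N} \<Longrightarrow> y \<in> B n \<Longrightarrow> iter \<phi> d y \<notin> B n"
    using no_two_cuts[of "2 * N"] by blast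
  have "\<exists>z\<in>V. E n y z" for y
  proof (cases "\<exists>j\<in>{-N<..0}. iter \<phi> j y \<in> B n")
    case True
    then obtain j where j: "j \<in> {-N<..0}" "iter \<phi> j y \<in> B n" by blast
    obtain k where k: "k \<in> {0<..N}" "iter \<phi> k y \<in> V" using N(2) by blast
    have "iter \<phi> i y \<notin> B n" if "i \<in> crossed k" for i
      using n[of "i - j" "iter \<phi> j y"] j k(1) that iter_add unfolding crossed_def by auto
    then show ?thesis using k(2) unfolding E_def J_def by blast
  next
    case False
    obtain k where k: "k \<in> {-N..0}" "iter \<phi> k y \<in> V" using N(3) by blast
    have "iter \<phi> i y \<notin> B n" if "i \<in> crossed k" for i
      using False k(1) that unfolding crossed_def by auto
    then show ?thesis using k(2) unfolding E_def J_def by blast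
  qed
  then show ?thesis by blast
qed

text \<open>The block of level m lies in that of level n, and the n-label shows all visits to
  \<open>B m\<close> there, since \<open>B m\<close> is built from clopen sets of index at most
  m.\<close>

lemma label_mono:
  assumes "m \<le> n" "l n y = l n z"
  shows "l m y = l m z"
proof -
  have eq: "k \<in> J m y \<longleftrightarrow> k \<in> J m z" if k: "k \<in> J n y" for k
  proof -
    have "iter \<phi> i y \<in> B m \<longleftrightarrow> iter \<phi> i z \<in> B m" if i: "i \<in> crossed k" for i
    proof -
      have "i \<in> J n y" using i k unfolding J_def crossed_def by auto
      moreover then have "i \<in> J n z" using assms(2) J_label by blast
      ultimately have "l n (iter \<phi> i y) = l n (iter \<phi> i z)" using label_shift assms(2) by simp
      then show ?thesis by (rule label_B[OF assms(1)])
    qed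
    then show ?thesis unfolding J_def by blast
  qed
  have J_eq: "J n y = J n z" using assms(2) J_label by blast
  have "J m y = J m z" using eq J_eq J_antimono[OF assms(1)] by blast
  moreover have "iter \<phi> k y \<in> C i \<longleftrightarrow> iter \<phi> k z \<in> C i" if "k \<in> J m y" "i \<le> m" for k i
  proof -
    have "k \<in> J n y" "k \<in> J n z" using that(1) J_antimono[OF assms(1)] J_eq by blast+
    then have "l n (iter \<phi> k y) = l n (iter \<phi> k z)" using label_shift assms(2) by simp
    then show ?thesis using label_C that(2) assms(1) by (meson order_trans)
  qed
  ultimately show ?thesis unfolding l_def by blast
qed

text \<open>If z is k steps from y and has the same label, the block of y is invariant under
  translation by k; a bounded set of positions allows only k = 0.\<close>

lemma E_label_inj:
  assumes "E m y z" "l m y = l m z"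
  shows "y = z"
proof -
  obtain k where k: "k \<in> J m y" "z = iter \<phi> k y" using assms(1) unfolding E_def by blast
  have *: "j + k \<in> J m y \<longleftrightarrow> j \<in> J m y" for j
    using J_shift[OF k(1), of j] k(2) assms(2) J_label by blast
  have mult: "int a * k \<in> J m y" for a
  proof (induction a)
    case (Suc a)
    then show ?case using *[of "int a * k"] by (simp add: algebra_simps)
  qed simp
  obtain N where N: "\<And>j. j \<in> J m y \<Longrightarrow> \<bar>j\<bar> \<le> N" using J_bound by blast
  have "k = 0"
  proof (rule ccontr)
    assume "k \<noteq> 0"
    have "\<bar>int (nat (N + 1)) * k\<bar> \<le> N" using N mult by blast
    moreover have "int (nat (N + 1)) \<le> \<bar>int (nat (N + 1)) * k\<bar>"
      using \<open>k \<noteq> 0\<close> mult_left_mono[of 1 "\<bar>k\<bar>" "int (nat (N + 1))"] by (simp add: abs_mult)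
    ultimately show False by linarith
  qed
  then show ?thesis using k(2) by simp
qed

sublocale tower E l
proof
  show "compact (UNIV :: 'a set)" by (rule comp)
  show "open V \<longleftrightarrow> (\<forall>y\<in>V. \<exists>m. \<forall>z. l m z = l m y \<longrightarrow> z \<in> V)" for V
  proof
    assume V: "open V"
    show "\<forall>y\<in>V. \<exists>m. \<forall>z. l m z = l m y \<longrightarrow> z \<in> V"
    proof
      fix y assume "y \<in> V"
      then obtain i where i: "y \<in> C i" "C i \<subseteq> V" using C_base V by blast
      then have "\<forall>z. l i z = l i y \<longrightarrow> z \<in> V" using label_C[OF order_refl] by blast
      then show "\<exists>m. \<forall>z. l m z = l m y \<longrightarrow> z \<in> V" by blast
    qed
  next
    assume V: "\<forall>y\<in>V. \<exists>m. \<forall>z. l m z = l m y \<longrightarrow> z \<in> V"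
    have "\<exists>U. open U \<and> y \<in> U \<and> U \<subseteq> V" if y: "y \<in> V" for y
    proof -
      obtain m where "\<forall>z. l m z = l m y \<longrightarrow> z \<in> V" using V y by blast
      then show ?thesis using open_label_class[of m y] by (intro exI[of _ "{z. l m z = l m y}"]) auto
    qed
    then show "open V" by (subst open_subopen) blast
  qed
  show "y = z" if "\<And>m. l m y = l m z" for y z
    using C_separates[of y z] label_C[OF order_refl that] by blast
  show "E m y y" for m y unfolding E_def by (intro bexI[of _ 0]) auto
  show "E m z y" if yz: "E m y z" for m y z
  proof -
    obtain k where k: "k \<in> J m y" "z = iter \<phi> k y" using yz unfolding E_def by blast
    have "- k \<in> J m z" using J_shift[OF k(1), of "- k"] k(2) by simp
    moreover have "y = iter \<phi> (- k) z" using k(2) iter_add by simp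
    ultimately show ?thesis unfolding E_def by blast
  qed
  show "E m y w" if yz: "E m y z" and zw: "E m z w" for m y z w
  proof -
    obtain k where k: "k \<in> J m y" "z = iter \<phi> k y" using yz unfolding E_def by blast
    obtain j where j: "j \<in> J m z" "w = iter \<phi> j z" using zw unfolding E_def by blast
    have "j + k \<in> J m y" using J_shift[OF k(1)] j(1) k(2) by simp
    moreover have "w = iter \<phi> (j + k) y" using k(2) j(2) iter_add by simp
    ultimately show ?thesis unfolding E_def by blast
  qed
  show "y = z" if "E m y z" "l m y = l m z" for m y z using E_label_inj that .
  show lift: "\<exists>z'. E m y' z' \<and> l m z' = l m z" if yz: "E m y z" and lab: "l m y = l m y'" for m y z y'
  proof -
    obtain k where k: "k \<in> J m y" "z = iter \<phi> k y" using yz unfolding E_def by blast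
    have k': "k \<in> J m y'" using k(1) lab J_label by blast
    then have "l m (iter \<phi> k y') = l m z" using label_shift k lab by simp
    then show ?thesis using k' unfolding E_def by blast
  qed
  show "E n y z" if "m \<le> n" "E m y z" for m n y z
    using that J_antimono unfolding E_def by blast
  show "l m y = l m z" if "m \<le> n" "l n y = l n z" for m n y z using label_mono that .
  show "E m y' z'" if mn: "m \<le> n" and yz: "E m y z" and yz': "E n y' z'"
    and lab: "l n y = l n y'" "l n z = l n z'" for m n y z y' z'
  proof -
    obtain k where k: "k \<in> J m y" "z = iter \<phi> k y" using yz unfolding E_def by blast
    have k': "k \<in> J m y'" using k(1) label_mono[OF mn lab(1)] J_label by blast
    have kn: "k \<in> J n y" "k \<in> J n y'" using k k' J_antimono[OF mn] by blast+
    \<comment> \<open>The point at position k from y' has the n-label of z' and lies in the same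
      block of level n, hence it is z'. So z' is already reached inside the block of level
      m.\<close>
    have same: "l n (iter \<phi> k y') = l n z'" using label_shift[OF kn(1)] label_shift[OF kn(2)] k(2) lab by simp
    obtain j where j: "j \<in> J n y'" "z' = iter \<phi> j y'" using yz' unfolding E_def by blast
    have "j - k \<in> J n (iter \<phi> k y')" using J_shift[OF kn(2), of "j - k"] j(1) by simp
    moreover have "z' = iter \<phi> (j - k) (iter \<phi> k y')" using j(2) iter_add by simp
    ultimately have "E n (iter \<phi> k y') z'" unfolding E_def by blast
    then have "iter \<phi> k y' = z'" using E_label_inj same by blast
    then show ?thesis using k' unfolding E_def by blast
  qed
  show "l 0 y = l 0 z" for y z
  proof -
    \<comment> \<open>At level 0 there is a cut before every point, so blocks are single
      points.\<close>
    have "J 0 u = {0}" for u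
    proof -
      have "k = 0" if "crossed k = {}" for k :: int
      proof (rule ccontr)
        assume "k \<noteq> 0"
        then have "k \<in> crossed k \<or> 0 \<in> crossed k" unfolding crossed_def by auto
        then show False using that by blast
      qed
      then show ?thesis unfolding J_def B_0 by auto
    qed
    then have "l 0 u = {(0, 0)}" for u unfolding l_def using C_0 by auto
    then show ?thesis by simp
  qed
  show "\<exists>n. \<forall>y. \<exists>z\<in>V. E n y z" if "open V" "V \<noteq> {}" for V using E_visits that .
qed

text \<open>Only finitely many positions are crossed, and each point outside K is outside
  \<open>B n\<close> for all large n.\<close>

lemma tail_rel_eq_cut_rel: "tail_rel y z \<longleftrightarrow> cut_rel \<phi> K y z"
proof
  assume "tail_rel y z"
  then obtain m k where "k \<in> J m y" "z = iter \<phi> k y" unfolding tail_rel_def E_def by blast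
  then show "cut_rel \<phi> K y z" unfolding cut_rel_def J_def using K_B by blast
next
  assume "cut_rel \<phi> K y z"
  then obtain k where k: "z = iter \<phi> k y" "\<forall>i\<in>crossed k. iter \<phi> i y \<notin> K"
    unfolding cut_rel_def by blast
  have fin: "finite (crossed k)" unfolding crossed_def by simp
  have "\<forall>i\<in>crossed k. eventually (\<lambda>n. iter \<phi> i y \<notin> B n) sequentially"
    using k(2) B_eventually unfolding eventually_sequentially by blast
  then have "eventually (\<lambda>n. \<forall>i\<in>crossed k. iter \<phi> i y \<notin> B n) sequentially"
    by (rule eventually_ball_finite[OF fin])
  then obtain n where "\<forall>i\<in>crossed k. iter \<phi> i y \<notin> B n" unfolding eventually_sequentially by blast
  then show "tail_rel y z" using k(1) unfolding tail_rel_def E_def J_def by blast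
qed

section \<open>Kakutani--Rokhlin partitions\<close>

text \<open>Columns correspond to the labels of points of \<open>B m\<close>; they are enumerated
  because columns are indexed by naturals.\<close>

definition base_labels :: "nat \<Rightarrow> nat \<Rightarrow> (int \<times> nat) set"
  where "base_labels m = (SOME e. bij_betw e {0..<card (l m ` B m)} (l m ` B m))"

text \<open>This is the first-return partition over \<open>B m\<close>, with columns split by label.
  The height is the first positive position outside the block; it is read off the label, hence
  common to the column.\<close>

definition tower_partition :: "nat \<Rightarrow> 'a kr"
  where "tower_partition m = \<lparr>cols = {0..<card (l m ` B m)},
    height = (\<lambda>i. LEAST j. 0 < j \<and> (int j, 0) \<notin> base_labels m i),
    atom = (\<lambda>i j. {z. \<exists>b\<in>B m. l m b = base_labels m i \<and> z = iter \<phi> (int j) b})\<rparr>"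

abbreviation "ht m \<equiv> height (tower_partition m)"

lemma base_labels_bij: "bij_betw (base_labels m) (cols (tower_partition m)) (l m ` B m)"
proof -
  have "finite (l m ` B m)" using finite_subset[OF _ finite_labels[of m], of "l m ` B m"] by blast
  then have "\<exists>e. bij_betw e {0..<card (l m ` B m)} (l m ` B m)" by (rule ex_bij_betw_nat_finite)
  then show ?thesis using someI_ex[of "\<lambda>e. bij_betw e {0..<card (l m ` B m)} (l m ` B m)"]
    unfolding base_labels_def tower_partition_def by simp
qed

lemma in_tower_atom:
  "z \<in> atom (tower_partition m) i j \<longleftrightarrow> (\<exists>b\<in>B m. l m b = base_labels m i \<and> z = iter \<phi> (int j) b)"
  unfolding tower_partition_def by simp

text \<open>A point of \<open>B m\<close> begins its block, since any way down from it crosses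
  position 0.\<close>

lemma J_base_nonneg: "b \<in> B m \<Longrightarrow> k \<in> J m b \<Longrightarrow> 0 \<le> k"
proof (rule ccontr)
  assume b: "b \<in> B m" "k \<in> J m b" and "\<not> 0 \<le> k"
  then have "0 \<in> crossed k" unfolding crossed_def by simp
  then have "iter \<phi> 0 b \<notin> B m" using b(2) unfolding J_def by blast
  then show False using b(1) by simp
qed

lemma J_base:
  assumes b: "b \<in> B m" "l m b = base_labels m i"
  shows "int j \<in> J m b \<longleftrightarrow> j < ht m i" and "0 < ht m i"
proof -
  have lab: "(int a, 0) \<in> base_labels m i \<longleftrightarrow> int a \<in> J m b" for a using J_label b(2) by simp
  have ht: "ht m i = (LEAST a. 0 < a \<and> int a \<notin> J m b)"
    unfolding tower_partition_def lab[symmetric] by simp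
  obtain N where N: "\<And>k. k \<in> J m b \<Longrightarrow> \<bar>k\<bar> \<le> N" using J_bound by blast
  then have "0 < nat (\<bar>N\<bar> + 1) \<and> int (nat (\<bar>N\<bar> + 1)) \<notin> J m b" by fastforce
  then have H: "0 < ht m i \<and> int (ht m i) \<notin> J m b" unfolding ht by (rule LeastI)
  then show "0 < ht m i" by blast
  have "int j \<in> J m b" if "j < ht m i"
    using not_less_Least[OF that[unfolded ht]] by (cases "j = 0") auto
  moreover have "j < ht m i" if j: "int j \<in> J m b"
  proof (rule ccontr)
    assume "\<not> j < ht m i"
    then have "crossed (int (ht m i)) \<subseteq> crossed (int j)" unfolding crossed_def by auto
    then show False using H j unfolding J_def by blast
  qed
  ultimately show "int j \<in> J m b \<longleftrightarrow> j < ht m i" by blast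
qed

lemma tower_atom_label:
  assumes y: "y \<in> atom (tower_partition m) i j" and j: "j < ht m i"
  shows "atom (tower_partition m) i j = {z. l m z = l m y}"
proof -
  obtain b where b: "b \<in> B m" "l m b = base_labels m i" "y = iter \<phi> (int j) b"
    using y in_tower_atom by blast
  have jb: "int j \<in> J m b" using J_base(1)[OF b(1,2)] j by blast
  show ?thesis
  proof (intro set_eqI iffI)
    fix z assume "z \<in> atom (tower_partition m) i j"
    then obtain c where c: "c \<in> B m" "l m c = base_labels m i" "z = iter \<phi> (int j) c"
      using in_tower_atom by blast
    have "int j \<in> J m c" using J_base(1)[OF c(1,2)] j by blast
    then show "z \<in> {z. l m z = l m y}" using label_shift jb b c by simp
  next
    fix z assume "z \<in> {z. l m z = l m y}"
    then have z: "l m z = l m y" by simp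
    have jy: "- int j \<in> J m y" using J_shift[OF jb, of "- int j"] b(3) by simp
    then have jz: "- int j \<in> J m z" using z J_label by blast
    have "l m (iter \<phi> (- int j) z) = l m (iter \<phi> (- int j) y)"
      using label_shift[OF jy] label_shift[OF jz] z by simp
    moreover have "iter \<phi> (- int j) y = b" using b(3) iter_add by simp
    ultimately have lb: "l m (iter \<phi> (- int j) z) = l m b" by simp
    then have "iter \<phi> (- int j) z \<in> B m" using label_B[OF order_refl lb] b(1) by blast
    moreover have "z = iter \<phi> (int j) (iter \<phi> (- int j) z)" using iter_add by simp
    ultimately show "z \<in> atom (tower_partition m) i j"
      unfolding in_tower_atom using lb b(2) by (intro bexI[of _ "iter \<phi> (- int j) z"]) auto
  qed
qed

lemma tower_cover:
  obtains i j where "i \<in> cols (tower_partition m)" "j < ht m i" "y \<in> atom (tower_partition m) i j"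
proof -
  obtain N where "\<And>y. \<exists>k\<in>{-N..0}. iter \<phi> k y \<in> B m"
    using return_times[OF B_clopen(1) B_nonempty] by blast
  then obtain k where k: "k \<in> {-N..0}" "iter \<phi> k y \<in> B m" by blast
  \<comment> \<open>The number of steps since the latest visit to \<open>B m\<close>, which is 0 if
    y itself lies there.\<close>
  define a where "a = (LEAST a. iter \<phi> (- int a) y \<in> B m)"
  have "iter \<phi> (- int (nat (- k))) y \<in> B m" using k by simp
  then have a: "iter \<phi> (- int a) y \<in> B m" unfolding a_def by (rule LeastI)
  let ?b = "iter \<phi> (- int a) y"
  have "iter \<phi> i ?b \<notin> B m" if i: "i \<in> crossed (int a)" for i
  proof -
    have "nat (int a - i) < a" "0 < i" "i \<le> int a" using i unfolding crossed_def by auto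
    then have "iter \<phi> (- int (nat (int a - i))) y \<notin> B m" unfolding a_def using not_less_Least by blast
    moreover have "- int (nat (int a - i)) = i + (- int a)" using \<open>i \<le> int a\<close> by simp
    ultimately show ?thesis using iter_add by simp
  qed
  then have J: "int a \<in> J m ?b" unfolding J_def by blast
  obtain i where i: "i \<in> cols (tower_partition m)" "base_labels m i = l m ?b"
    using base_labels_bij[of m] a unfolding bij_betw_def by (metis imageE image_eqI)
  have "a < ht m i" using J_base(1)[OF a i(2)[symmetric]] J by blast
  moreover have "y \<in> atom (tower_partition m) i a"
    unfolding in_tower_atom using a i(2) iter_add by (intro bexI[of _ ?b]) auto
  ultimately show thesis using that i(1) by blast
qed

lemma tower_disjoint:
  assumes "i \<in> cols (tower_partition m)" "i' \<in> cols (tower_partition m)" "j < ht m i" "j' < ht m i'"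
    and z: "z \<in> atom (tower_partition m) i j" "z \<in> atom (tower_partition m) i' j'"
  shows "i = i' \<and> j = j'"
proof -
  obtain b where b: "b \<in> B m" "l m b = base_labels m i" "z = iter \<phi> (int j) b"
    using z in_tower_atom by blast
  obtain c where c: "c \<in> B m" "l m c = base_labels m i'" "z = iter \<phi> (int j') c"
    using z in_tower_atom by blast
  have jb: "int j \<in> J m b" and jc: "int j' \<in> J m c" using J_base(1) b c assms by blast+
  have "- int j \<in> J m z" "- int j' \<in> J m z"
    using J_shift[OF jb, of "- int j"] J_shift[OF jc, of "- int j'"]
    unfolding b(3)[symmetric] c(3)[symmetric] by simp_all
  \<comment> \<open>Both b and c begin the common block of z, so neither displacement between them
    can be negative.\<close>
  then have J: "- int j' + int j \<in> J m b" "- int j + int j' \<in> J m c"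
    using J_shift[OF jb, of "- int j'"] J_shift[OF jc, of "- int j"]
    unfolding b(3)[symmetric] c(3)[symmetric] by blast+
  have jj: "j = j'" using J_base_nonneg[OF b(1) J(1)] J_base_nonneg[OF c(1) J(2)] by linarith
  have "b = iter \<phi> (- int j) z" using iter_add[of "- int j" "int j" b] b(3) by simp
  moreover have "c = iter \<phi> (- int j') z" using iter_add[of "- int j'" "int j'" c] c(3) by simp
  ultimately have "b = c" using jj by simp
  then have "base_labels m i = base_labels m i'" using b(2) c(2) by simp
  then show ?thesis using base_labels_bij[of m] assms(1,2) jj unfolding bij_betw_def inj_on_def by blast
qed

lemma kr_base_tower: "kr_base (tower_partition m) = B m"
proof (intro set_eqI iffI)
  fix y assume "y \<in> kr_base (tower_partition m)"
  then show "y \<in> B m" unfolding kr_base_def in_tower_atom UN_iff by auto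
next
  fix y assume y: "y \<in> B m"
  obtain i where i: "i \<in> cols (tower_partition m)" "base_labels m i = l m y"
    using base_labels_bij[of m] y unfolding bij_betw_def by (metis imageE image_eqI)
  then show "y \<in> kr_base (tower_partition m)"
    unfolding kr_base_def in_tower_atom UN_iff using y by (intro bexI[of _ i]) auto
qed

lemma tower_atoms: "kr_atoms (tower_partition m) = range (\<lambda>y. {z. l m z = l m y})"
proof (intro set_eqI iffI)
  fix U assume "U \<in> kr_atoms (tower_partition m)"
  then obtain i j where ij: "i \<in> cols (tower_partition m)" "j < ht m i" "U = atom (tower_partition m) i j"
    unfolding kr_atoms_def kr_ix_def by auto
  obtain b where "b \<in> B m" "l m b = base_labels m i"
    using base_labels_bij[of m] ij(1) unfolding bij_betw_def by (metis imageE image_eqI)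
  then have "iter \<phi> (int j) b \<in> U" unfolding ij(3) in_tower_atom by blast
  then show "U \<in> range (\<lambda>y. {z. l m z = l m y})" using tower_atom_label[OF _ ij(2)] ij(3) by blast
next
  fix U assume "U \<in> range (\<lambda>y. {z. l m z = l m y})"
  then obtain y where y: "U = {z. l m z = l m y}" by blast
  obtain i j where ij: "i \<in> cols (tower_partition m)" "j < ht m i" "y \<in> atom (tower_partition m) i j"
    by (rule tower_cover)
  then have "U = atom (tower_partition m) i j" using tower_atom_label y by blast
  then show "U \<in> kr_atoms (tower_partition m)" unfolding kr_atoms_def kr_ix_def using ij by auto
qed

lemma kr_partition_tower: "kr_partition \<phi> (tower_partition m)"
  unfolding kr_partition_def
proof (intro conjI)
  show "finite (cols (tower_partition m))" unfolding tower_partition_def by simp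
  show "\<forall>i\<in>cols (tower_partition m). 0 < ht m i"
  proof
    fix i assume "i \<in> cols (tower_partition m)"
    then obtain b where "b \<in> B m" "l m b = base_labels m i"
      using base_labels_bij[of m] unfolding bij_betw_def by (metis imageE image_eqI)
    then show "0 < ht m i" by (rule J_base(2))
  qed
  have "closed {z. l m z = c}" for c
    unfolding closed_def open_iff by auto
  then show "\<forall>U\<in>kr_atoms (tower_partition m). open U \<and> closed U \<and> U \<noteq> {}"
    unfolding tower_atoms using open_label by auto
  show "disjoint_family_on (\<lambda>(i, j). atom (tower_partition m) i j) (kr_ix (tower_partition m))"
    unfolding disjoint_family_on_def kr_ix_def using tower_disjoint by fastforce
  show "\<Union> (kr_atoms (tower_partition m)) = UNIV" unfolding tower_atoms by auto
  have "\<phi> ` atom (tower_partition m) i j = atom (tower_partition m) i (j + 1)" for i j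
  proof (intro set_eqI iffI)
    fix z assume "z \<in> \<phi> ` atom (tower_partition m) i j"
    then obtain b where "b \<in> B m" "l m b = base_labels m i" "z = \<phi> (iter \<phi> (int j) b)"
      by (auto simp: in_tower_atom)
    then show "z \<in> atom (tower_partition m) i (j + 1)"
      unfolding in_tower_atom using iter_Suc[OF bij, of "int j" b] by (auto simp: add.commute)
  next
    fix z assume "z \<in> atom (tower_partition m) i (j + 1)"
    then obtain b where b: "b \<in> B m" "l m b = base_labels m i" "z = iter \<phi> (int (j + 1)) b"
      using in_tower_atom by blast
    then have "z = \<phi> (iter \<phi> (int j) b)" using iter_Suc[OF bij, of "int j" b] by (simp add: add.commute)
    moreover have "iter \<phi> (int j) b \<in> atom (tower_partition m) i j" using b in_tower_atom by blast
    ultimately show "z \<in> \<phi> ` atom (tower_partition m) i j" by blast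
  qed
  then show "\<forall>i\<in>cols (tower_partition m). \<forall>j. j + 1 < ht m i \<longrightarrow>
      \<phi> ` atom (tower_partition m) i j = atom (tower_partition m) i (j + 1)"
    by blast
qed

text \<open>This supplies the existence that gives meaning to \<open>SOME\<close> in
  \<open>Gamma_group\<close>. The bases are the sets \<open>B n\<close>, which intersect in
  K.\<close>

lemma kr_sequence_tower:
  assumes "K = {x}"
  shows "kr_sequence \<phi> x tower_partition"
  unfolding kr_sequence_def
proof (intro conjI allI impI)
  show "kr_partition \<phi> (tower_partition n)" for n by (rule kr_partition_tower)
  show "kr_refines (tower_partition (Suc n)) (tower_partition n)" for n
    unfolding kr_refines_def tower_atoms kr_base_tower
  proof (intro conjI ballI)
    show "B (Suc n) \<subseteq> B n" by (rule B_antimono) simp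
    fix V assume "V \<in> range (\<lambda>y. {z. l (Suc n) z = l (Suc n) y})"
    then obtain y where "V = {z. l (Suc n) z = l (Suc n) y}" by blast
    then have "V \<subseteq> {z. l n z = l n y}" using l_mono[OF le_SucI[OF order_refl], of n] by blast
    then show "\<exists>U\<in>range (\<lambda>y. {z. l n z = l n y}). V \<subseteq> U" by blast
  qed
  show "\<exists>N. \<forall>n\<ge>N. \<exists>T\<subseteq>kr_atoms (tower_partition n). V = \<Union> T" if V: "open V \<and> closed V" for V
  proof -
    obtain i where i: "V = C i" using C_all V by blast
    have "\<exists>T\<subseteq>kr_atoms (tower_partition n). V = \<Union> T" if n: "i \<le> n" for n
    proof (intro exI conjI)
      let ?T = "(\<lambda>y. {z. l n z = l n y}) ` V"
      show "?T \<subseteq> kr_atoms (tower_partition n)" unfolding tower_atoms by blast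
      show "V = \<Union> ?T" using label_C[OF n] unfolding i by blast
    qed
    then show ?thesis by blast
  qed
  show "(\<Inter>n. kr_base (tower_partition n)) = {x}"
  proof -
    have "y \<in> K" if "\<And>n. y \<in> B n" for y using B_eventually[of y] that by blast
    then have "(\<Inter>n. B n) = K" using K_B by blast
    then show ?thesis unfolding kr_base_tower using assms by simp
  qed
qed

end

section \<open>Orbits of the groups of Kakutani--Rokhlin partitions\<close>

context cantor_dyn begin

lemma kr_iter_image:
  assumes "kr_partition \<phi> P" "i \<in> cols P" "j + n < height P i"
  shows "iter \<phi> (int n) ` atom P i j = atom P i (j + n)"
  using assms(3)
proof (induction n)
  case 0
  then show ?case by simp
next
  case (Suc n)
  have "iter \<phi> (int (Suc n)) ` atom P i j = \<phi> ` (iter \<phi> (int n) ` atom P i j)"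
    using iter_Suc[OF bij, of "int n"] by (simp add: image_image add.commute)
  also have "\<dots> = atom P i (j + Suc n)"
    using Suc assms(1,2) unfolding kr_partition_def by simp
  finally show ?case .
qed

lemma kr_iter:
  assumes P: "kr_partition \<phi> P" "i \<in> cols P" "j < height P i" "z \<in> atom P i j"
    and k: "0 \<le> int j + k" "int j + k < int (height P i)"
  shows "iter \<phi> k z \<in> atom P i (nat (int j + k))"
proof (cases "0 \<le> k")
  case True
  then have "iter \<phi> k z \<in> iter \<phi> (int (nat k)) ` atom P i j" using P(4) by simp
  also have "\<dots> = atom P i (j + nat k)" by (rule kr_iter_image[OF P(1,2)]) (use k True in linarith)
  finally show ?thesis using True by (simp add: nat_add_distrib)
next
  case False
  let ?j = "nat (int j + k)"
  have j: "?j + nat (- k) = j" using False k by linarith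
  then have "iter \<phi> (int (nat (- k))) ` atom P i ?j = atom P i j"
    using kr_iter_image[OF P(1,2), of ?j "nat (- k)"] P(3) by simp
  then obtain w where w: "w \<in> atom P i ?j" "z = iter \<phi> (- k) w" using P(4) False by force
  then have "iter \<phi> k z = w" using iter_add by simp
  then show ?thesis using w by simp
qed

lemma kr_cover:
  assumes "kr_partition \<phi> P"
  obtains i j where "i \<in> cols P" "j < height P i" "z \<in> atom P i j"
proof -
  have "z \<in> \<Union> (kr_atoms P)" using assms unfolding kr_partition_def by simp
  then show thesis using that unfolding kr_atoms_def kr_ix_def by auto
qed

lemma kr_unique:
  assumes "kr_partition \<phi> P" "i \<in> cols P" "j < height P i" "z \<in> atom P i j"
    "i' \<in> cols P" "j' < height P i'" "z \<in> atom P i' j'"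
  shows "i = i' \<and> j = j'"
proof (rule ccontr)
  assume "\<not> ?thesis"
  then have ne: "(i, j) \<noteq> (i', j')" by simp
  have ix: "(i, j) \<in> kr_ix P" "(i', j') \<in> kr_ix P" using assms unfolding kr_ix_def by auto
  have "disjoint_family_on (\<lambda>(i, j). atom P i j) (kr_ix P)"
    using assms(1) unfolding kr_partition_def by blast
  from disjoint_family_onD[OF this ix ne] have "atom P i j \<inter> atom P i' j' = {}" by simp
  then show False using assms(4,7) by blast
qed

lemma kr_base_unique:
  assumes "kr_partition \<phi> P" "i \<in> cols P" "j < height P i" "z \<in> atom P i j" "z \<in> kr_base P"
  shows "j = 0"
proof -
  obtain i' where i': "i' \<in> cols P" "z \<in> atom P i' 0" using assms(5) unfolding kr_base_def by blast
  have "0 < height P i'" using assms(1) i'(1) unfolding kr_partition_def by blast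
  then show ?thesis using kr_unique[OF assms(1-4) i'(1) _ i'(2)] by blast
qed

text \<open>The point \<phi> z lies at a positive level of some column; stepping down from it stays
  in that column, and disjointness of the atoms makes it the column of z.\<close>

lemma kr_ascend:
  assumes P: "kr_partition \<phi> P" "i \<in> cols P" "j < height P i" "z \<in> atom P i j"
    and "\<phi> z \<notin> kr_base P"
  shows "j + 1 < height P i"
proof -
  obtain i' j' where ij: "i' \<in> cols P" "j' < height P i'" "\<phi> z \<in> atom P i' j'"
    by (rule kr_cover[OF P(1)])
  have "j' \<noteq> 0"
  proof
    assume "j' = 0"
    then have "\<phi> z \<in> kr_base P" using ij unfolding kr_base_def by blast
    then show False using assms(5) by blast
  qed
  then have "iter \<phi> (- 1) (\<phi> z) \<in> atom P i' (nat (int j' + - 1))"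
    by (intro kr_iter[OF P(1) ij]) (use ij(2) in auto)
  moreover have "iter \<phi> (- 1) (\<phi> z) = z" using iter_add[of "-1" 1 z] by simp
  moreover have "nat (int j' + - 1) = j' - 1" by simp
  ultimately have "i = i' \<and> j = j' - 1"
    using kr_unique[OF P ij(1)] ij(2) by (metis less_imp_diff_less)
  then show ?thesis using ij(2) \<open>j' \<noteq> 0\<close> by auto
qed

text \<open>The element is the involution that exchanges two levels of one column and fixes all
  other points. It is continuous because atoms are clopen.\<close>

lemma kr_group_swap:
  assumes P: "kr_partition \<phi> P" "i \<in> cols P" "j + n < height P i" "z \<in> atom P i j"
  obtains g where "g \<in> kr_group \<phi> P" "g z = iter \<phi> (int n) z" "g (iter \<phi> (int n) z) = z"
proof (cases "n = 0")
  case True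
  have "homeo (\<lambda>y :: 'a. y)" unfolding homeo_def by (rule exI, rule homeomorphism_ident)
  then have "(\<lambda>y. y) \<in> kr_group \<phi> P" unfolding kr_group_def by (auto intro!: exI[of _ 0])
  then show thesis using that True by simp
next
  case False
  let ?U = "atom P i j"
  let ?V = "atom P i (j + n)"
  define g where "g = (\<lambda>y. if y \<in> ?U then iter \<phi> (int n) y else if y \<in> ?V then iter \<phi> (- int n) y else y)"
  have j: "j < height P i" using P(3) by simp
  have UV: "iter \<phi> (int n) ` ?U = ?V" by (rule kr_iter_image[OF P(1-3)])
  have disj: "y \<notin> ?V" if "y \<in> ?U" for y using kr_unique[OF P(1,2) j that P(2,3)] False by auto
  have undo: "iter \<phi> (- int n) (iter \<phi> (int n) y) = y" for y using iter_add by simp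
  have gg: "g (g y) = y" for y
  proof -
    consider "y \<in> ?U" | "y \<notin> ?U" "y \<in> ?V" | "y \<notin> ?U" "y \<notin> ?V" by blast
    then show ?thesis
    proof cases
      case 1
      then have "iter \<phi> (int n) y \<in> ?V" using UV by blast
      then have "iter \<phi> (int n) y \<notin> ?U" using disj by blast
      then show ?thesis using 1 \<open>iter \<phi> (int n) y \<in> ?V\<close> undo unfolding g_def by simp
    next
      case 2
      then obtain u where u: "u \<in> ?U" "y = iter \<phi> (int n) u" using UV by blast
      then have "g y = u" using 2 undo unfolding g_def by simp
      then show ?thesis using u unfolding g_def by simp
    next
      case 3
      then show ?thesis unfolding g_def by simp
    qed
  qed
  have clopen: "open (atom P i a)" "closed (atom P i a)" if "a < height P i" for a
    using P(1,2) that unfolding kr_partition_def kr_atoms_def kr_ix_def by auto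
  have "continuous_on (?U \<union> - ?U) g"
    unfolding g_def
  proof (rule continuous_on_cases)
    show "closed ?U" "closed (- ?U)" using clopen[OF j] by auto
    show "continuous_on ?U (iter \<phi> (int n))" by (rule continuous_on_subset[OF cont_iter]) simp
    have "continuous_on (?V \<union> - ?V) (\<lambda>y. if y \<in> ?V then iter \<phi> (- int n) y else y)"
    proof (rule continuous_on_cases)
      show "closed ?V" "closed (- ?V)" using clopen[OF P(3)] by auto
      show "continuous_on ?V (iter \<phi> (- int n))" by (rule continuous_on_subset[OF cont_iter]) simp
    qed (auto intro: continuous_on_id)
    then show "continuous_on (- ?U) (\<lambda>y. if y \<in> ?V then iter \<phi> (- int n) y else y)"
      by (rule continuous_on_subset) simp
  qed auto
  then have "continuous_on UNIV g" by simp
  then have "homeomorphism UNIV UNIV g g" by (intro homeomorphismI) (auto simp: gg)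
  then have "homeo g" unfolding homeo_def by blast
  moreover have "\<exists>k::int. 0 \<le> int j' + k \<and> int j' + k < int (height P i') \<and> (\<forall>y\<in>atom P i' j'. g y = iter \<phi> k y)"
    if ij: "i' \<in> cols P" "j' < height P i'" for i' j'
  proof -
    consider "i' = i" "j' = j" | "i' = i" "j' = j + n"
      | "\<And>y. y \<in> atom P i' j' \<Longrightarrow> y \<notin> ?U \<and> y \<notin> ?V"
      using kr_unique[OF P(1,2) j _ ij] kr_unique[OF P(1,2,3) _ ij] by blast
    then show ?thesis
    proof cases
      case 1
      then show ?thesis using P(3) unfolding g_def by (intro exI[of _ "int n"]) auto
    next
      case 2
      then show ?thesis using P(3) disj unfolding g_def by (intro exI[of _ "- int n"]) auto
    next
      case 3
      then show ?thesis using ij(2) unfolding g_def by (intro exI[of _ 0]) auto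
    qed
  qed
  ultimately have "g \<in> kr_group \<phi> P" unfolding kr_group_def by blast
  moreover have "g z = iter \<phi> (int n) z" using P(4) unfolding g_def by simp
  ultimately show thesis using that gg[of z] by simp
qed

text \<open>A way inside one column meets the base at most at its lowest point, so it does not cross
  the cut at x. Conversely, the finitely many points passed differ from x and leave the decreasing
  bases, so at a late stage the way climbs in one column and a swap of levels realises it.\<close>

lemma orbit_rel_kr_groups:
  assumes "kr_sequence \<phi> x \<A>"
  shows "orbit_rel (\<Union>n. kr_group \<phi> (\<A> n)) y y' \<longleftrightarrow> cut_rel \<phi> {x} y y'"
proof -
  have P: "kr_partition \<phi> (\<A> n)" and ref: "kr_base (\<A> (Suc n)) \<subseteq> kr_base (\<A> n)" for n
    using assms unfolding kr_sequence_def kr_refines_def by auto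
  have base: "(\<Inter>n. kr_base (\<A> n)) = {x}" using assms unfolding kr_sequence_def by simp
  have cut: "cut_rel \<phi> {x} y y'" if orb: "orbit_rel (\<Union>n. kr_group \<phi> (\<A> n)) y y'"
  proof -
    from orb obtain g n where g: "g \<in> kr_group \<phi> (\<A> n)" "y' = g y" unfolding orbit_rel_def by blast
    obtain i j where ij: "i \<in> cols (\<A> n)" "j < height (\<A> n) i" "y \<in> atom (\<A> n) i j"
      by (rule kr_cover[OF P])
    obtain k where k: "0 \<le> int j + k" "int j + k < int (height (\<A> n) i)"
      "\<forall>y\<in>atom (\<A> n) i j. g y = iter \<phi> k y"
      using g(1) ij unfolding kr_group_def by blast
    have "iter \<phi> a y \<noteq> x" if a: "a \<in> crossed k" for a
    proof
      assume ax: "iter \<phi> a y = x"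
      \<comment> \<open>In either direction a crossed position is strictly above the lower end of
        the way, hence at positive level; but x lies in every base, at level 0.\<close>
      have ja: "0 < int j + a" "int j + a < int (height (\<A> n) i)"
        using a k(1,2) ij(2) unfolding crossed_def by auto
      have "iter \<phi> a y \<in> atom (\<A> n) i (nat (int j + a))"
        using kr_iter[OF P ij] ja by simp
      moreover have "iter \<phi> a y \<in> kr_base (\<A> n)" using ax base by blast
      ultimately have "nat (int j + a) = 0"
        using kr_base_unique[OF P ij(1)] ja by (metis nat_less_iff order_less_imp_le)
      then show False using ja(1) by simp
    qed
    then show ?thesis unfolding cut_rel_def using g(2) k(3) ij(3) by auto
  qed
  have step: "\<exists>g\<in>(\<Union>n. kr_group \<phi> (\<A> n)). g z = iter \<phi> (int n) z \<and> g (iter \<phi> (int n) z) = z"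
    if nocut: "\<forall>a\<in>crossed (int n). iter \<phi> a z \<noteq> x" for z n
  proof -
    have "\<exists>N. \<forall>m\<ge>N. w \<notin> kr_base (\<A> m)" if w: "w \<noteq> x" for w
    proof -
      obtain N where N: "w \<notin> kr_base (\<A> N)" using base w by blast
      have "kr_base (\<A> m) \<subseteq> kr_base (\<A> N)" if "N \<le> m" for m
        using lift_Suc_antimono_le[of "\<lambda>n. kr_base (\<A> n)", OF ref that] .
      then show ?thesis using N by blast
    qed
    then have "\<forall>a\<in>crossed (int n). eventually (\<lambda>m. iter \<phi> a z \<notin> kr_base (\<A> m)) sequentially"
      unfolding eventually_sequentially using nocut by blast
    then have "eventually (\<lambda>m. \<forall>a\<in>crossed (int n). iter \<phi> a z \<notin> kr_base (\<A> m)) sequentially"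
      by (rule eventually_ball_finite[rotated]) (simp add: crossed_def)
    then obtain m where m: "\<forall>a\<in>crossed (int n). iter \<phi> a z \<notin> kr_base (\<A> m)"
      unfolding eventually_sequentially by blast
    obtain i j where ij: "i \<in> cols (\<A> m)" "j < height (\<A> m) i" "z \<in> atom (\<A> m) i j"
      by (rule kr_cover[OF P])
    have "j + b < height (\<A> m) i" if "b \<le> n" for b
      using that
    proof (induction b)
      case 0
      then show ?case using ij(2) by simp
    next
      case (Suc b)
      then have jb: "j + b < height (\<A> m) i" by simp
      have "iter \<phi> (int b) z \<in> atom (\<A> m) i (j + b)"
        using kr_iter[OF P ij, of "int b"] jb by (simp add: nat_int_add)
      moreover have "\<phi> (iter \<phi> (int b) z) \<notin> kr_base (\<A> m)"
        using m[rule_format, of "int (Suc b)"] Suc.prems iter_Suc[OF bij, of "int b" z]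
        unfolding crossed_def by (simp add: add.commute)
      ultimately show ?case using kr_ascend[OF P ij(1) jb] by simp
    qed
    then have "j + n < height (\<A> m) i" by simp
    then obtain g where "g \<in> kr_group \<phi> (\<A> m)" "g z = iter \<phi> (int n) z" "g (iter \<phi> (int n) z) = z"
      using kr_group_swap[OF P ij(1) _ ij(3)] by blast
    then show ?thesis by blast
  qed
  have "orbit_rel (\<Union>n. kr_group \<phi> (\<A> n)) y y'" if yy': "cut_rel \<phi> {x} y y'"
  proof -
    obtain k where k: "y' = iter \<phi> k y" "\<forall>a\<in>crossed k. iter \<phi> a y \<noteq> x"
      using yy' unfolding cut_rel_def by blast
    show ?thesis
    proof (cases "0 \<le> k")
      case True
      then have "\<forall>a\<in>crossed (int (nat k)). iter \<phi> a y \<noteq> x" using k(2) by simp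
      from step[OF this] obtain g where "g \<in> (\<Union>n. kr_group \<phi> (\<A> n))" "g y = y'"
        using True k(1) by auto
      then show ?thesis unfolding orbit_rel_def by blast
    next
      case False
      have "iter \<phi> a y' \<noteq> x" if "a \<in> crossed (- k)" for a
        using crossed_shift[OF that, of k] k iter_add by auto
      then have "\<forall>a\<in>crossed (int (nat (- k))). iter \<phi> a y' \<noteq> x" using False by simp
      moreover have "y = iter \<phi> (int (nat (- k))) y'" using k(1) iter_add False by simp
      ultimately obtain g where "g \<in> (\<Union>n. kr_group \<phi> (\<A> n))" "g y = y'"
        using step[of "nat (- k)" y'] by auto
      then show ?thesis unfolding orbit_rel_def by blast
    qed
  qed
  then show ?thesis using cut by blast
qed

end

section \<open>Absorbing one cut\<close>

context cantor_dyn begin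

lemma uncountable_open:
  assumes "open (V :: 'a set)" "V \<noteq> {}"
  shows "uncountable V"
proof
  assume "countable V"
  then have "countable (\<Union>k. iter \<phi> k ` V)" by auto
  moreover have "(\<Union>k. iter \<phi> k ` V) = UNIV"
  proof -
    have "y \<in> (\<Union>k. iter \<phi> k ` V)" for y
    proof -
      obtain k where "iter \<phi> k y \<in> V" using minimal[OF assms] by blast
      moreover have "y = iter \<phi> (- k) (iter \<phi> k y)" using iter_add by simp
      ultimately show ?thesis by blast
    qed
    then show ?thesis by blast
  qed
  ultimately show False using uncountable by simp
qed

text \<open>The limit c is fixed in advance, outside the orbit of x. The first component of a state
  collects the orbits used so far; it is countable and cannot contain the uncountable neighbourhood
  \<open>W n\<close> of c, which leaves room for the next point.\<close>

lemma independent_sequence: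
  "\<exists>c xs. xs (0 :: nat) = x \<and> (\<forall>n k. xs n \<noteq> iter \<phi> k c) \<and>
    (\<forall>m n k. xs m = iter \<phi> k (xs n) \<longrightarrow> m = n) \<and>
    (\<forall>i. c \<in> C i \<longrightarrow> (\<exists>N. \<forall>n\<ge>N. xs n \<in> C i))"
proof -
  define orb where "orb y = range (\<lambda>k. iter \<phi> k y)" for y
  have c_orb: "countable (orb y)" for y unfolding orb_def by simp
  have orb_sym: "z \<in> orb y" if yz: "y \<in> orb z" for y z
  proof -
    obtain k where "y = iter \<phi> k z" using yz unfolding orb_def by blast
    then have "z = iter \<phi> (- k) y" using iter_add by simp
    then show ?thesis unfolding orb_def by blast
  qed
  obtain c where c: "c \<notin> orb x" using c_orb[of x] uncountable by (metis UNIV_eq_I)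
  define W where "W n = {z. \<forall>i\<le>n. c \<in> C i \<longrightarrow> z \<in> C i}" for n
  have W: "open (W n)" "c \<in> W n" for n
  proof -
    have "W n = (\<Inter>i\<in>{i\<in>{..n}. c \<in> C i}. C i)" unfolding W_def by auto
    then show "open (W n)" using C_clopen by (auto intro!: open_INT)
    show "c \<in> W n" unfolding W_def by blast
  qed
  define P where "P n s \<longleftrightarrow> (countable (fst s) \<and> orb c \<subseteq> fst s \<and> snd s \<notin> fst s \<and> (n = 0 \<longrightarrow> snd s = x) \<and>
    (n \<noteq> 0 \<longrightarrow> snd s \<in> W n))" for n :: nat and s :: "'a set \<times> 'a"
  define R where "R s s' \<longleftrightarrow> fst s' = fst s \<union> orb (snd s)" for s s' :: "'a set \<times> 'a"
  have "\<exists>\<sigma>. \<forall>n. P n (\<sigma> n) \<and> R (\<sigma> n) (\<sigma> (Suc n))"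
  proof (rule dependent_nat_choice)
    have "x \<notin> orb c" using c orb_sym by blast
    then show "\<exists>s. P 0 s" unfolding P_def using c_orb by (intro exI[of _ "(orb c, x)"]) simp
    fix s n assume s: "P n s"
    let ?A = "fst s \<union> orb (snd s)"
    have A: "countable ?A" using s c_orb[of "snd s"] unfolding P_def by simp
    have "W (Suc n) \<noteq> {}" using W(2) by blast
    then have "uncountable (W (Suc n))" by (rule uncountable_open[OF W(1)])
    then have "\<not> W (Suc n) \<subseteq> ?A" using countable_subset[OF _ A] by blast
    then obtain y where y: "y \<in> W (Suc n)" "y \<notin> ?A" by blast
    then show "\<exists>s'. P (Suc n) s' \<and> R s s'"
      using A s unfolding P_def R_def by (intro exI[of _ "(?A, y)"]) auto
  qed
  then obtain \<sigma> where \<sigma>: "\<And>n. P n (\<sigma> n)" "\<And>n. R (\<sigma> n) (\<sigma> (Suc n))" by blast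
  define xs where "xs n = snd (\<sigma> n)" for n
  define A where "A n = fst (\<sigma> n)" for n
  have A: "orb c \<subseteq> A n" "xs n \<notin> A n" "A (Suc n) = A n \<union> orb (xs n)" for n
    using \<sigma>[of n] unfolding P_def R_def xs_def A_def by auto
  have xs0: "xs 0 = x" using \<sigma>(1)[of 0] unfolding P_def xs_def by simp
  have xsW: "xs n \<in> W n" if "n \<noteq> 0" for n using \<sigma>(1)[of n] that unfolding P_def xs_def by simp
  have sub: "orb (xs m) \<subseteq> A n" if "m < n" for m n
    using that
  proof (induction n)
    case (Suc n)
    then show ?case using A(3)[of n] by (cases "m = n") auto
  qed simp
  have f1: "xs n \<noteq> iter \<phi> k c" for n k using A(1,2)[of n] unfolding orb_def by blast
  have f2: "m = n" if mn: "xs m = iter \<phi> k (xs n)" for m n k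
  proof (rule ccontr)
    assume "m \<noteq> n"
    then consider "m < n" | "n < m" by linarith
    moreover have "xs m \<in> orb (xs n)" using mn unfolding orb_def by blast
    moreover then have "xs n \<in> orb (xs m)" by (rule orb_sym)
    ultimately show False using sub A(2) by blast
  qed
  have f3: "\<exists>N. \<forall>n\<ge>N. xs n \<in> C i" if i: "c \<in> C i" for i
  proof -
    have "xs n \<in> C i" if "Suc i \<le> n" for n using xsW[of n] that i unfolding W_def by simp
    then show ?thesis by blast
  qed
  have "xs 0 = x \<and> (\<forall>n k. xs n \<noteq> iter \<phi> k c) \<and> (\<forall>m n k. xs m = iter \<phi> k (xs n) \<longrightarrow> m = n) \<and>
    (\<forall>i. c \<in> C i \<longrightarrow> (\<exists>N. \<forall>n\<ge>N. xs n \<in> C i))"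
    using xs0 f1 f2 f3 by blast
  then show ?thesis by blast
qed

lemma cut_rel_antimono: "K' \<subseteq> K \<Longrightarrow> cut_rel \<phi> K y z \<Longrightarrow> cut_rel \<phi> K' y z"
  unfolding cut_rel_def by blast

lemma inv_iter: "inv \<phi> y = iter \<phi> (- 1) y"
  using iter_pred[OF bij, of 0 y] by simp

text \<open>Removing a cut d glues the two half orbits that start at d and at its predecessor.\<close>

lemma cut_rel_glue:
  assumes sub: "K' \<subseteq> K" and sparse: "\<And>y k. y \<in> K \<Longrightarrow> iter \<phi> k y \<in> K \<Longrightarrow> k = 0"
  shows "cut_rel \<phi> K' y z \<longleftrightarrow> cut_rel \<phi> K y z \<or> (\<exists>d\<in>K - K'.
    (cut_rel \<phi> K y d \<and> cut_rel \<phi> K z (inv \<phi> d)) \<or> (cut_rel \<phi> K y (inv \<phi> d) \<and> cut_rel \<phi> K z d))"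
    (is "?L \<longleftrightarrow> ?R")
proof
  assume ?L
  then obtain k where k: "z = iter \<phi> k y" "\<And>i. i \<in> crossed k \<Longrightarrow> iter \<phi> i y \<notin> K'"
    unfolding cut_rel_def by blast
  show ?R
  proof (cases "\<forall>i\<in>crossed k. iter \<phi> i y \<notin> K")
    case True
    then show ?thesis using k(1) unfolding cut_rel_def by blast
  next
    case False
    then obtain a where a: "a \<in> crossed k" "iter \<phi> a y \<in> K" by blast
    let ?d = "iter \<phi> a y"
    have d: "?d \<in> K - K'" using a k(2) by blast
    \<comment> \<open>K meets this orbit only at \<open>?d\<close>, so the two pieces of the way, on
      either side of the cut at \<open>?d\<close>, are free of cuts.\<close>
    have only: "iter \<phi> b y \<notin> K" if "b \<noteq> a" for b
      using sparse[OF a(2), of "b - a"] that iter_add by auto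
    have seg: "cut_rel \<phi> K (iter \<phi> p y) (iter \<phi> q y)" if "p \<le> q" "a \<notin> {p<..q}" for p q
    proof -
      have "iter \<phi> i (iter \<phi> p y) \<notin> K" if "i \<in> crossed (q - p)" for i
        using only[of "i + p"] that \<open>p \<le> q\<close> \<open>a \<notin> {p<..q}\<close> iter_add unfolding crossed_def by auto
      moreover have "iter \<phi> q y = iter \<phi> (q - p) (iter \<phi> p y)" using iter_add by simp
      ultimately show ?thesis unfolding cut_rel_def by blast
    qed
    have pred: "inv \<phi> ?d = iter \<phi> (a - 1) y" using inv_iter iter_add by simp
    show ?thesis
    proof (cases "0 < k")
      case True
      then have "0 \<le> a - 1" "a \<le> k" using a(1) unfolding crossed_def by auto
      then have "cut_rel \<phi> K y (inv \<phi> ?d)" "cut_rel \<phi> K ?d z"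
        using seg[of 0 "a - 1"] seg[of a k] pred k(1) by simp_all
      then show ?thesis using d cut_rel_sym[OF bij] by blast
    next
      case False
      then have "k \<le> a - 1" "a \<le> 0" using a(1) unfolding crossed_def by auto
      then have "cut_rel \<phi> K z (inv \<phi> ?d)" "cut_rel \<phi> K ?d y"
        using seg[of k "a - 1"] seg[of a 0] pred k(1) by simp_all
      then show ?thesis using d cut_rel_sym[OF bij] by blast
    qed
  qed
next
  have glue: "cut_rel \<phi> K' (inv \<phi> d) d" if "d \<in> K - K'" for d
  proof -
    have "crossed 1 = {1}" unfolding crossed_def by auto
    moreover have "iter \<phi> 1 (inv \<phi> d) = d" using bij by (simp add: bij_is_surj surj_f_inv_f)
    ultimately show ?thesis using that unfolding cut_rel_def by (intro exI[of _ 1]) auto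
  qed
  assume ?R
  then consider "cut_rel \<phi> K y z"
    | d where "d \<in> K - K'" "cut_rel \<phi> K y d" "cut_rel \<phi> K z (inv \<phi> d)"
    | d where "d \<in> K - K'" "cut_rel \<phi> K y (inv \<phi> d)" "cut_rel \<phi> K z d"
    by blast
  then show ?L
  proof cases
    case 1
    then show ?thesis by (rule cut_rel_antimono[OF sub])
  next
    case 2
    then show ?thesis
      using cut_rel_trans[OF bij] cut_rel_sym[OF bij] glue cut_rel_antimono[OF sub] by meson
  next
    case 3
    then show ?thesis
      using cut_rel_trans[OF bij] cut_rel_sym[OF bij] glue cut_rel_antimono[OF sub] by meson
  qed
qed

text \<open>The extension theorem is applied to K together with its predecessors. This set meets
  each class of the cut relation at most once, because d and its predecessor are separated by the
  cut at d.\<close>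

lemma hotel:
  "\<exists>g K. homeo g \<and> x \<in> K \<and> (\<forall>y k. y \<in> K \<longrightarrow> iter \<phi> k y \<in> K \<longrightarrow> k = 0) \<and>
    g ` K = K - {x} \<and> (\<forall>d\<in>K. g (inv \<phi> d) = inv \<phi> (g d)) \<and>
    (\<forall>y z. cut_rel \<phi> K (g y) (g z) \<longleftrightarrow> cut_rel \<phi> K y z)"
proof -
  obtain c and xs :: "nat \<Rightarrow> 'a" where "xs 0 = x \<and> (\<forall>n k. xs n \<noteq> iter \<phi> k c) \<and>
    (\<forall>m n k. xs m = iter \<phi> k (xs n) \<longrightarrow> m = n) \<and>
    (\<forall>i. c \<in> C i \<longrightarrow> (\<exists>N. \<forall>n\<ge>N. xs n \<in> C i))"
    using independent_sequence[of x] by (elim exE)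
  then have xs0: "xs 0 = x" and xs_c: "\<And>n k. xs n \<noteq> iter \<phi> k c"
    and xs_xs: "\<And>m n k. xs m = iter \<phi> k (xs n) \<Longrightarrow> m = n"
    and conv: "\<And>i. c \<in> C i \<Longrightarrow> \<exists>N. \<forall>n\<ge>N. xs n \<in> C i"
    by blast+
  have xs_inj: "m = n" if "xs m = xs n" for m n using xs_xs[of m 0 n] that by simp
  have xs_ne_c: "xs n \<noteq> c" for n using xs_c[of n 0] by simp
  have finite_outside: "finite {n. xs n \<notin> V}" if V: "open V" "c \<in> V" for V
  proof -
    obtain i where i: "c \<in> C i" "C i \<subseteq> V" using C_base[OF V] by blast
    obtain N where N: "\<forall>n\<ge>N. xs n \<in> C i" using conv[OF i(1)] by blast
    have "n < N" if "xs n \<notin> V" for n using N i(2) that by (meson not_le subsetD)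
    then have "{n. xs n \<notin> V} \<subseteq> {..<N}" by blast
    then show ?thesis using finite_subset by blast
  qed
  \<comment> \<open>A neighbourhood of c misses only finitely many of the points. An arbitrary index
    set A is allowed because preimages in \<open>closed_shift\<close> select subsequences.\<close>
  have closed_seq: "closed (insert c (xs ` A))" for A
  proof -
    have "\<exists>U. open U \<and> y \<in> U \<and> U \<subseteq> - insert c (xs ` A)" if y: "y \<notin> insert c (xs ` A)" for y
    proof -
      obtain i where i: "c \<in> C i" "y \<notin> C i" using C_separates[of c y] y by blast
      have "finite (xs ` (A \<inter> {n. xs n \<notin> C i}))" using finite_outside[OF C_clopen(1) i(1)] by simp
      then have "open (- C i \<inter> - (xs ` (A \<inter> {n. xs n \<notin> C i})))"
        using closed_finite C_clopen by (intro open_Int) auto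
      then show ?thesis using i y by (intro exI[of _ "- C i \<inter> - (xs ` (A \<inter> {n. xs n \<notin> C i}))"]) blast
    qed
    then have "open (- insert c (xs ` A))" by (subst open_subopen) auto
    then show ?thesis by (simp add: closed_def)
  qed
  define K where "K = insert c (range xs)"
  have sparse: "k = 0" if y: "y \<in> K" "iter \<phi> k y \<in> K" for y k
  proof -
    have eq: "iter \<phi> k y = y"
      using y unfolding K_def
    proof (elim insertE imageE)
      fix n assume "iter \<phi> k y = c" "y = xs n"
      then have "xs n = iter \<phi> (- k) c" using iter_add[of "- k" k y] by simp
      then show ?thesis using xs_c by blast
    next
      fix m n assume "iter \<phi> k y = xs m" "y = xs n"
      then show ?thesis using xs_xs[of m k n] by simp
    next
      fix m assume "iter \<phi> k y = xs m" "y = c"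
      then show ?thesis using xs_c[of m k] by simp
    qed simp
    then show ?thesis by (rule free)
  qed
  interpret cut_dyn \<phi> C K
    by unfold_locales (use closed_seq[of UNIV] sparse in \<open>auto simp: K_def\<close>)
  have label_cont_on_criterion: "label_cont_on L h" if clos: "\<And>V. closed V \<Longrightarrow> closed {p \<in> L. h p \<in> V}" for L h
    unfolding label_cont_on_def
  proof (intro ballI allI)
    fix p m assume p: "p \<in> L"
    have "closed (- {z. l m z = l m (h p)})" using open_label by (rule closed_Compl)
    then have "open (- {q \<in> L. h q \<in> - {z. l m z = l m (h p)}})" using clos open_Compl by blast
    moreover have "p \<in> - {q \<in> L. h q \<in> - {z. l m z = l m (h p)}}" by simp
    ultimately obtain M where
      "\<forall>q. l M q = l M p \<longrightarrow> q \<in> - {q \<in> L. h q \<in> - {z. l m z = l m (h p)}}"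
      unfolding open_iff by blast
    then show "\<exists>M. \<forall>q\<in>L. l M q = l M p \<longrightarrow> l m (h q) = l m (h p)" by blast
  qed
  \<comment> \<open>The preimage either contains c and is closed by \<open>closed_seq\<close>, or is
    finite since t is injective and only finitely many of the points lie in V. Both the shift and
    its inverse are instances.\<close>
  have closed_shift: "closed {p \<in> insert c (xs ` A). F p \<in> V}"
    if F: "F c = c" "\<And>n. n \<in> A \<Longrightarrow> F (xs n) = xs (t n)" and t: "inj_on t A" and V: "closed V" for F A V t
  proof (cases "c \<in> V")
    case True
    then have "{p \<in> insert c (xs ` A). F p \<in> V} = insert c (xs ` {n \<in> A. xs (t n) \<in> V})" using F by auto
    then show ?thesis using closed_seq by simp
  next
    case False
    have "finite {n. xs n \<notin> - V}" using finite_outside[of "- V"] V False by auto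
    then have "finite {n \<in> A. t n \<in> {n. xs n \<in> V}}"
      using finite_vimage_IntI[OF _ t, of "{n. xs n \<in> V}"] by (simp add: vimage_def Int_def conj_commute)
    moreover have "{p \<in> insert c (xs ` A). F p \<in> V} = xs ` {n \<in> A. t n \<in> {n. xs n \<in> V}}" using F False by auto
    ultimately show ?thesis using closed_finite by simp
  qed
  have \<phi>_inv: "\<phi> (inv \<phi> y) = y" "inv \<phi> (\<phi> y) = y" for y
    using bij by (simp_all add: bij_is_surj surj_f_inv_f bij_is_inj)
  have pre: "inv \<phi> ` A = {y. iter \<phi> 1 y \<in> A}" for A
  proof (intro set_eqI iffI)
    fix y assume "y \<in> {y. iter \<phi> 1 y \<in> A}"
    then have "\<phi> y \<in> A" by simp
    then show "y \<in> inv \<phi> ` A" using \<phi>_inv(2)[of y] by (metis imageI)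
  qed (auto simp: \<phi>_inv)
  have disj: "inv \<phi> y \<notin> K" if "y \<in> K" for y using sparse[OF that, of "- 1"] inv_iter by auto
  have disj': "\<phi> y \<notin> K" if "y \<in> K" for y using sparse[OF that, of 1] by auto
  define twice where "twice A = A \<union> inv \<phi> ` A" for A
  \<comment> \<open>F is carried to the predecessors of K by conjugation with \<phi>. By
    \<open>disj\<close> no predecessor lies in K, so the two cases do not conflict.\<close>
  define ext where "ext F y = (if y \<in> K then F y else inv \<phi> (F (\<phi> y)))" for F y
  have closed_twice: "closed (twice A)" if "closed A" for A
    unfolding twice_def pre using that closed_iter_vimage by blast
  have cont_ext: "label_cont_on (twice A) (ext F)" if A: "A \<subseteq> K"
    and clos: "\<And>V. closed V \<Longrightarrow> closed {p \<in> A. F p \<in> V}" for A F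
  proof (rule label_cont_on_criterion)
    fix V :: "'a set" assume V: "closed V"
    have "{p \<in> twice A. ext F p \<in> V} =
      {p \<in> A. F p \<in> V} \<union> {y. iter \<phi> 1 y \<in> {p \<in> A. F p \<in> {z. iter \<phi> (- 1) z \<in> V}}}"
      using A disj disj' \<phi>_inv unfolding twice_def ext_def pre inv_iter[symmetric] by auto
    then show "closed {p \<in> twice A. ext F p \<in> V}"
      using closed_Un[OF clos[OF V] closed_iter_vimage[OF clos[OF closed_iter_vimage[OF V]]], of 1 "- 1"]
      by simp
  qed
  have sparse_twice: "sparse (twice K)"
    unfolding sparse_def tail_rel_eq_cut_rel
  proof (intro ballI impI)
    fix p q assume p: "p \<in> twice K" and q: "q \<in> twice K" and "cut_rel \<phi> K p q"
    then obtain k where k: "q = iter \<phi> k p" "\<And>i. i \<in> crossed k \<Longrightarrow> iter \<phi> i p \<notin> K"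
      unfolding cut_rel_def by blast
    obtain a u where a: "a \<in> {0, 1}" "u \<in> K" "u = iter \<phi> a p"
      using p \<phi>_inv unfolding twice_def by force
    obtain b v where b: "b \<in> {0, 1}" "v \<in> K" "v = iter \<phi> b q"
      using q \<phi>_inv unfolding twice_def by force
    have "iter \<phi> (b + k - a) u \<in> K" using a b k(1) iter_add by simp
    \<comment> \<open>The points of K attached to p and q lie in one orbit and hence coincide. If k
      is not 0, it is 1 or -1, and that single step crosses the cut at u.\<close>
    then have kab: "k = a - b" using sparse[OF a(2)] by force
    show "p = q"
    proof (cases "k = 0")
      case True
      then show ?thesis using k(1) by simp
    next
      case False
      then have "a \<in> crossed k" using kab a(1) b(1) unfolding crossed_def by auto
      then show ?thesis using k(2) a(2,3) by blast
    qed
  qed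
  define s where "s y = (if y = c then c else xs (Suc (inv xs y)))" for y
  \<comment> \<open>On the image of K under \<open>s\<close> all indices are positive, so truncated
    subtraction gives the true inverse there.\<close>
  define s' where "s' y = (if y = c then c else xs (inv xs y - 1))" for y
  have inv_xs: "inv xs (xs n) = n" for n using xs_inj by (simp add: inj_def)
  have s: "s c = c" "s (xs n) = xs (Suc n)" for n unfolding s_def using xs_ne_c inv_xs by auto
  have s': "s' c = c" "s' (xs n) = xs (n - 1)" for n unfolding s'_def using xs_ne_c inv_xs by auto
  have sK: "s ` K = insert c (xs ` {1..})"
  proof -
    have "s ` K = insert c (xs ` range Suc)" by (simp add: K_def image_image s)
    moreover have "range Suc = {1..}" by (auto simp: image_iff Suc_le_eq gr0_conv_Suc)
    ultimately show ?thesis by simp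
  qed
  have sKK: "s ` K \<subseteq> K" by (subst sK) (auto simp: K_def)
  have s's: "s' (s y) = y" if "y \<in> K" for y using that s s' unfolding K_def by auto
  have ext_inv: "ext F (inv \<phi> y) = inv \<phi> (F y)" "ext F y = F y" if "y \<in> K" for F y
    unfolding ext_def using disj that \<phi>_inv by auto
  have image: "ext s ` twice K = twice (s ` K)"
    unfolding twice_def image_Un image_image using ext_inv by auto
  have clos_s: "closed {p \<in> K. s p \<in> V}" if "closed V" for V
    using closed_shift[of s UNIV Suc V] s that unfolding K_def by simp
  have clos_s': "closed {p \<in> s ` K. s' p \<in> V}" if "closed V" for V
  proof -
    have "inj_on (\<lambda>n. n - 1) {1 :: nat..}" by (rule inj_onI) auto
    from closed_shift[OF s'(1) s'(2) this that] show ?thesis unfolding sK .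
  qed
  have "closed (s ` K)" unfolding sK by (rule closed_seq)
  then have closed': "closed (ext s ` twice K)" unfolding image by (rule closed_twice)
  have "twice (s ` K) \<subseteq> twice K" using sKK unfolding twice_def by blast
  then have sparse': "sparse (ext s ` twice K)" using sparse_twice unfolding image sparse_def by blast
  have cont': "label_cont_on (ext s ` twice K) (ext s')" unfolding image by (rule cont_ext[OF sKK clos_s'])
  have retract: "ext s' (ext s p) = p" if "p \<in> twice K" for p
    using that ext_inv s's sKK unfolding twice_def by auto
  obtain g where g: "homeo g" "\<And>p. p \<in> twice K \<Longrightarrow> g p = ext s p" "\<And>y z. tail_rel (g y) (g z) \<longleftrightarrow> tail_rel y z"
    using extend_homeomorphism[OF closed_twice[OF K_closed] sparse_twice closed' sparse'
        cont_ext[OF order_refl clos_s] cont' retract] by blast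
  have gK: "g d = s d" "g (inv \<phi> d) = inv \<phi> (s d)" if "d \<in> K" for d
    using g(2)[of d] g(2)[of "inv \<phi> d"] ext_inv[OF that] that unfolding twice_def by auto
  have "g ` K = K - {x}"
  proof -
    have "g ` K = insert c (xs ` {1..})" using gK sK by (metis image_cong)
    also have "\<dots> = K - {x}"
    proof -
      have "xs n \<noteq> x" if "n \<in> {1..}" for n using xs_inj[of n 0] xs0 that by auto
      moreover have "range xs = insert x (xs ` {1..})"
      proof -
        have "(UNIV :: nat set) = insert 0 {1..}" by auto
        then have "xs ` UNIV = xs ` (insert 0 {1..})" by simp
        then show ?thesis using xs0 by simp
      qed
      moreover have "c \<noteq> x" using xs_ne_c[of 0] xs0 by blast
      ultimately show ?thesis unfolding K_def by blast
    qed
    finally show ?thesis .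
  qed
  moreover have "x \<in> K" unfolding K_def using xs0 by blast
  moreover have "g (inv \<phi> d) = inv \<phi> (g d)" if "d \<in> K" for d using gK[OF that] by simp
  moreover have "cut_rel \<phi> K (g y) (g z) \<longleftrightarrow> cut_rel \<phi> K y z" for y z
    using g(3) unfolding tail_rel_eq_cut_rel .
  ultimately have result: "homeo g \<and> x \<in> K \<and> (\<forall>y k. y \<in> K \<longrightarrow> iter \<phi> k y \<in> K \<longrightarrow> k = 0) \<and>
    g ` K = K - {x} \<and> (\<forall>d\<in>K. g (inv \<phi> d) = inv \<phi> (g d)) \<and>
    (\<forall>y z. cut_rel \<phi> K (g y) (g z) \<longleftrightarrow> cut_rel \<phi> K y z)"
    using g(1) sparse by simp
  show ?thesis by (rule exI[of _ g], rule exI[of _ K], rule result)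
qed

end

section \<open>The Cantor space and its clopen sets\<close>

lemma uncountable_binary_sequences: "uncountable (UNIV :: (nat \<Rightarrow> bool) set)"
proof
  assume "countable (UNIV :: (nat \<Rightarrow> bool) set)"
  then obtain f :: "nat \<Rightarrow> nat \<Rightarrow> bool" where f: "range f = UNIV"
    using uncountable_def by blast
  then obtain n where "f n = (\<lambda>i. \<not> f i i)" by (metis UNIV_I imageE)
  then have "f n n = (\<not> f n n)" by (rule fun_cong)
  then show False by simp
qed

lemma compact_binary_sequences: "compact (UNIV :: (nat \<Rightarrow> bool) set)"
proof -
  have "compact_space (euclidean :: bool topology)"
    by (simp add: compact_space_def compactin_euclidean_iff finite_imp_compact)
  then have "compact_space (product_topology (\<lambda>i::nat. euclidean :: bool topology) UNIV)"
    by (simp add: compact_space_product_topology)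
  then show ?thesis
    by (simp add: euclidean_product_topology compact_space_def compactin_euclidean_iff)
qed

lemma binary_cylinder_base:
  fixes U :: "(nat \<Rightarrow> bool) set"
  assumes "open U" "f \<in> U"
  obtains N where "\<And>h. (\<And>i. i < N \<Longrightarrow> h i = f i) \<Longrightarrow> h \<in> U"
proof -
  have "openin (product_topology (\<lambda>i::nat. euclidean :: bool topology) UNIV) U"
    using assms(1) open_fun_def by blast
  from product_topology_open_contains_basis[OF this assms(2)] obtain X where
    X: "f \<in> (\<Pi>\<^sub>E i\<in>UNIV. X i)" "finite {i. X i \<noteq> topspace (euclidean :: bool topology)}" "(\<Pi>\<^sub>E i\<in>UNIV. X i) \<subseteq> U"
    by auto
  then obtain N where N: "\<And>i. X i \<noteq> UNIV \<Longrightarrow> i < N"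
    using finite_nat_set_iff_bounded[of "{i. X i \<noteq> UNIV}"] by auto
  have "h \<in> U" if h: "\<And>i. i < N \<Longrightarrow> h i = f i" for h
  proof -
    have "h i \<in> X i" for i
      using N[of i] h[of i] X(1) by (cases "X i = UNIV") auto
    then show ?thesis using X(3) by auto
  qed
  then show thesis using that by blast
qed

text \<open>A clopen set is compact, hence a finite union of cylinders, and there are only countably
  many cylinders. This allows all clopen sets to be enumerated.\<close>

lemma cantor_dyn_exists:
  fixes \<phi> :: "'a::topological_space \<Rightarrow> 'a"
  assumes "(UNIV :: 'a set) homeomorphic (UNIV :: (nat \<Rightarrow> bool) set)" and "minimal_homeo \<phi>"
  shows "\<exists>C. cantor_dyn \<phi> C"
proof -
  obtain g :: "'a \<Rightarrow> nat \<Rightarrow> bool" and g' where g: "homeomorphism UNIV UNIV g g'"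
    using assms(1) unfolding homeomorphic_def by blast
  have gg: "g' (g y) = y" "g (g' w) = w" for y w using g unfolding homeomorphism_def by auto
  have cg: "continuous_on UNIV g" and cg': "continuous_on UNIV g'" using g unfolding homeomorphism_def by auto
  have img: "range g' = UNIV" using g unfolding homeomorphism_def by auto
  have compact: "compact (UNIV :: 'a set)"
    using compact_continuous_image[OF cg' compact_binary_sequences] img by simp
  have unc: "uncountable (UNIV :: 'a set)"
  proof
    assume "countable (UNIV :: 'a set)"
    then have "countable (g ` UNIV)" by simp
    moreover have "g ` UNIV = UNIV" using g unfolding homeomorphism_def by auto
    ultimately show False using uncountable_binary_sequences by simp
  qed
  define cyl where "cyl w = {y. \<forall>i<length w. g y i = w ! i}" for w
  have coord: "open {y. g y i = b}" "closed {y. g y i = b}" for i b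
  proof -
    have "continuous_on UNIV (\<lambda>y. g y i)"
      using continuous_on_product_then_coordinatewise[OF cg] by simp
    then show "open {y. g y i = b}" "closed {y. g y i = b}"
      using continuous_on_open_vimage[OF open_UNIV, of "\<lambda>y. g y i"] open_discrete[of "{b}"]
        continuous_on_closed_vimage[OF closed_UNIV, of "\<lambda>y. g y i"] closed_singleton[of b]
      by (auto simp: vimage_def)
  qed
  have "cyl w = (\<Inter>i\<in>{..<length w}. {y. g y i = w ! i})" for w unfolding cyl_def by auto
  then have cyl: "open (cyl w)" "closed (cyl w)" for w
    using coord by (auto intro!: open_INT closed_INT)
  have base: "\<exists>w. y \<in> cyl w \<and> cyl w \<subseteq> V" if V: "open V" "y \<in> V" for V y
  proof -
    have "open (g' -` V)" using continuous_on_open_vimage[OF open_UNIV, of g'] cg' V(1) by auto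
    then obtain N where N: "\<And>h. (\<And>i. i < N \<Longrightarrow> h i = g y i) \<Longrightarrow> h \<in> g' -` V"
      using binary_cylinder_base[of "g' -` V" "g y"] V(2) gg by auto
    have "z \<in> V" if "z \<in> cyl (map (g y) [0..<N])" for z
      using N[of "g z"] that gg unfolding cyl_def by simp
    moreover have "y \<in> cyl (map (g y) [0..<N])" unfolding cyl_def by simp
    ultimately show ?thesis by blast
  qed
  have "{V :: 'a set. open V \<and> closed V} \<subseteq> (\<lambda>F. \<Union> (cyl ` F)) ` Collect finite"
  proof
    fix V :: "'a set" assume "V \<in> {V. open V \<and> closed V}"
    then have V: "open V" "closed V" by auto
    then have "compact V" using compact_Int_closed[OF compact V(2)] by simp
    let ?W = "{w. cyl w \<subseteq> V}"
    have cover: "V \<subseteq> (\<Union>w\<in>?W. cyl w)" using base[OF V(1)] by blast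
    obtain F where F: "F \<subseteq> ?W" "finite F" "V \<subseteq> (\<Union>w\<in>F. cyl w)"
      by (rule compactE_image[OF \<open>compact V\<close> cyl(1) cover])
    then have "V = \<Union> (cyl ` F)" by blast
    then show "V \<in> (\<lambda>F. \<Union> (cyl ` F)) ` Collect finite" using F(2) by blast
  qed
  then have cnt: "countable {V :: 'a set. open V \<and> closed V}"
    by (rule countable_subset) (rule countable_image[OF countable_Collect_finite])
  have ne: "{V :: 'a set. open V \<and> closed V} \<noteq> {}" by (auto intro: exI[of _ UNIV])
  \<comment> \<open>The enumeration is shifted by one to give the whole space index 0.\<close>
  define C where "C i = (case i of 0 \<Rightarrow> UNIV | Suc j \<Rightarrow> from_nat_into {V :: 'a set. open V \<and> closed V} j)" for i
  have C: "open (C i) \<and> closed (C i)" for i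
    using from_nat_into[OF ne] unfolding C_def by (cases i) auto
  have C_all: "\<exists>i. V = C i" if V: "open V" "closed V" for V
  proof -
    have "V \<in> {V. open V \<and> closed V}" using V by blast
    then obtain n where "from_nat_into {V :: 'a set. open V \<and> closed V} n = V"
      using from_nat_into_surj[OF cnt] by blast
    then show ?thesis unfolding C_def by (intro exI[of _ "Suc n"]) simp
  qed
  obtain \<psi> where \<psi>: "homeomorphism UNIV UNIV \<phi> \<psi>"
    using assms(2) unfolding minimal_homeo_def homeo_def by blast
  have bij: "bij \<phi>"
    by (rule o_bij[of \<psi>]) (use \<psi> in \<open>auto simp: homeomorphism_def\<close>)
  have "inv \<phi> = \<psi>"
    by (rule inv_unique_comp) (use \<psi> in \<open>auto simp: homeomorphism_def\<close>)
  then have cont: "continuous_on UNIV \<phi>" "continuous_on UNIV (inv \<phi>)"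
    using \<psi> by (auto simp: homeomorphism_def)
  have "cantor_dyn \<phi> C"
  proof
    show "C 0 = UNIV" unfolding C_def by simp
    show "\<exists>i. y \<in> C i \<and> C i \<subseteq> V" if V: "open V" "y \<in> V" for V y
      using base[OF V] C_all[OF cyl] by metis
    show "\<exists>i. y \<in> C i \<and> z \<notin> C i" if yz: "y \<noteq> z" for y z
    proof -
      have "g y \<noteq> g z" using gg yz by metis
      then obtain i where i: "g y i \<noteq> g z i" by blast
      obtain j where "{u. g u i = g y i} = C j" using C_all[OF coord] by blast
      then have "y \<in> C j" "z \<notin> C j" using i by auto
      then show ?thesis by blast
    qed
    show "\<exists>k. iter \<phi> k y \<in> V" if V: "open V" "V \<noteq> {}" for V y
    proof -
      have "closure (range (\<lambda>n. iter \<phi> n y)) = UNIV" using assms(2) unfolding minimal_homeo_def by blast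
      then have "V \<inter> range (\<lambda>n. iter \<phi> n y) \<noteq> {}"
        using open_Int_closure_eq_empty[OF V(1), of "range (\<lambda>n. iter \<phi> n y)"] V(2) by simp
      then show ?thesis by blast
    qed
    show "open (C i)" "closed (C i)" for i using C by blast+
    show "\<exists>i. V = C i" if "open V" "closed V" for V using C_all that .
  qed (fact compact unc bij cont)+
  then show ?thesis by blast
qed

theorem theorem6p1:
  fixes \<phi> :: "'a::topological_space \<Rightarrow> 'a" and x :: 'a
  assumes "(UNIV :: 'a set) homeomorphic (UNIV :: (nat \<Rightarrow> bool) set)"
    and "minimal_homeo \<phi>"
  shows "isomorphic_rel (orbit_rel (range (iter \<phi>))) (orbit_rel (Gamma_group \<phi> x))"
proof -
  obtain C where "cantor_dyn \<phi> C" using cantor_dyn_exists[OF assms] by blast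
  then interpret cantor_dyn \<phi> C .
  interpret X: cut_dyn \<phi> C "{x}"
    by unfold_locales (use closed_singleton free in auto)
  have "kr_sequence \<phi> x (SOME \<A>. kr_sequence \<phi> x \<A>)"
    by (rule someI[of "kr_sequence \<phi> x", OF X.kr_sequence_tower[OF refl]])
  then have Gamma: "orbit_rel (Gamma_group \<phi> x) y z \<longleftrightarrow> cut_rel \<phi> {x} y z" for y z
    unfolding Gamma_group_def Let_def by (rule orbit_rel_kr_groups)
  have orbit: "orbit_rel (range (iter \<phi>)) y z \<longleftrightarrow> cut_rel \<phi> {} y z" for y z
    unfolding orbit_rel_def cut_rel_def by blast
  obtain g K where "homeo g \<and> x \<in> K \<and> (\<forall>y k. y \<in> K \<longrightarrow> iter \<phi> k y \<in> K \<longrightarrow> k = 0) \<and>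
    g ` K = K - {x} \<and> (\<forall>d\<in>K. g (inv \<phi> d) = inv \<phi> (g d)) \<and>
    (\<forall>y z. cut_rel \<phi> K (g y) (g z) \<longleftrightarrow> cut_rel \<phi> K y z)"
    using hotel[of x] by (elim exE)
  then have g: "homeo g" "x \<in> K" and sparse: "\<And>y k. y \<in> K \<Longrightarrow> iter \<phi> k y \<in> K \<Longrightarrow> k = 0"
    and gK: "g ` K = K - {x}" "\<And>d. d \<in> K \<Longrightarrow> g (inv \<phi> d) = inv \<phi> (g d)"
    and gE: "\<And>y z. cut_rel \<phi> K (g y) (g z) \<longleftrightarrow> cut_rel \<phi> K y z"
    by simp_all
  let ?G = "\<lambda>y z d. (cut_rel \<phi> K y d \<and> cut_rel \<phi> K z (inv \<phi> d)) \<or> (cut_rel \<phi> K y (inv \<phi> d) \<and> cut_rel \<phi> K z d)"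
  have glue: "cut_rel \<phi> K' y z \<longleftrightarrow> cut_rel \<phi> K y z \<or> (\<exists>d\<in>K - K'. ?G y z d)"
    if "K' \<subseteq> K" for K' y z
    by (rule cut_rel_glue[OF that]) (rule sparse)
  \<comment> \<open>The full orbit relation arises from the cut relation by gluing at all d in K.
    The map g carries these gluings to those at the points of K other than x, which leave exactly
    the cut at x.\<close>
  have "cut_rel \<phi> {} y z \<longleftrightarrow> cut_rel \<phi> {x} (g y) (g z)" for y z
  proof -
    have "cut_rel \<phi> {} y z \<longleftrightarrow> cut_rel \<phi> K y z \<or> (\<exists>d\<in>K. ?G y z d)"
      using glue[of "{}" y z] by simp
    also have "\<dots> \<longleftrightarrow> cut_rel \<phi> K (g y) (g z) \<or> (\<exists>d\<in>K. ?G (g y) (g z) (g d))"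
      using gE gK(2) by metis
    also have "\<dots> \<longleftrightarrow> cut_rel \<phi> K (g y) (g z) \<or> (\<exists>d\<in>g ` K. ?G (g y) (g z) d)"
      by simp
    also have "\<dots> \<longleftrightarrow> cut_rel \<phi> {x} (g y) (g z)"
      unfolding gK(1) using glue[of "{x}" "g y" "g z"] g(2) by simp
    finally show ?thesis .
  qed
  then show ?thesis unfolding isomorphic_rel_def using g(1) Gamma orbit by blast
qed
end
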